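(* Let $\tau$ be in the upper half plane, let $S^a_\alpha\in\mathbb C$ ($a=0,1,2,3$; $\alpha=1,2,3$), and let $$L(z)=\sum_{a=0}^3\sum_{\alpha=1}^3 S^a_\alpha\,\varphi_\alpha(z-\omega_a)\,\sigma_\alpha .$$ Let $\varsigma$ be the involution $(\varsigma L)(z)=-L(-z)$ and $L^{\pm}=\frac12(L\pm\varsigma L)$. Then the invariant part is $$ L^{+}(z)=\sum_{\alpha=1}^3\bigl(S_\alpha\varphi_\alpha(z)+\tilde\nu_\alpha\varphi_\alpha(z-\omega_\alpha)\bigr)\sigma_\alpha=\sum_{\alpha=1}^3\Bigl(S_\alpha\varphi_\alpha(z)+\nu'_\alpha\frac1{\varphi_\alpha(z)}\Bigr)\sigma_\alpha , $$ where $S_\alpha=S^0_\alpha$, $\tilde\nu_\alpha=S^\alpha_\alpha$ and $$\nu'_\alpha=-\tilde\nu_\alpha\,\exp(-2\pi i\,\omega_\alpha\partial_\tau\omega_\alpha)\left(\frac{\vartheta'(0)}{\vartheta(\omega_\alpha)}\right)^2 .$$ Moreover, on the locus $L^-\equiv0$ the quantity $\tilde\nu_\alpha^2$ equals the Casimir value $\sum_{\beta=1}^3(S^\alpha_\beta)^2$, $\alpha=1,2,3$; in particular $\tilde\nu_\alpha$ is a constant (determined up to sign) once the Casimirs are fixed.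
   Context: Half-periods: $\omega_0=0$, $\omega_1=\frac12$, $\omega_2=\frac\tau2$, $\omega_3=\frac{1+\tau}2$, so $\partial_\tau\omega_1=0$, $\partial_\tau\omega_2=\partial_\tau\omega_3=\frac12$. $\sigma_1,\sigma_2,\sigma_3$ are the Pauli matrices. $\vartheta(z)=\vartheta(z,\tau)=\sum_{j\in\mathbb Z}\exp\bigl(\pi i(j+\frac12)^2\tau+2\pi i(j+\frac12)(z+\frac12)\bigr)$ is the odd theta function, and $$\phi(u,z)=\frac{\vartheta(u+z)\vartheta'(0)}{\vartheta(u)\vartheta(z)},\qquad \varphi_\alpha(z)=\exp(2\pi i z\,\partial_\tau\omega_\alpha)\,\phi(z,\omega_\alpha).$$ Identities are between meromorphic matrix functions of $z$. The variables $(S^a_1,S^a_2,S^a_3)$ are coordinates on a coadjoint orbit of $SL(2,\mathbb C)$ for each $a$, with Casimir function $\sum_\beta(S^a_\beta)^2$. *)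

theory Defs
  imports "HOL-Complex_Analysis.Complex_Analysis"
begin

text \<open>Indices are natural numbers: \<open>a \<in> {0..3}\<close> labels the points \<open>\<omega>\<^sub>a\<close>, and
  \<open>\<alpha>, \<beta> \<in> {1..3}\<close> label the Pauli matrices. Values at other indices are irrelevant.\<close>

definition half_period :: "nat \<Rightarrow> complex \<Rightarrow> complex" where
  "half_period a \<tau> =
     (if a = 1 then 1 / 2 else if a = 2 then \<tau> / 2 else if a = 3 then (1 + \<tau>) / 2 else 0)"

definition theta :: "complex \<Rightarrow> complex \<Rightarrow> complex" where
  "theta \<tau> z = (\<Sum>\<^sub>\<infinity>j\<in>(UNIV :: int set).
     exp (of_real pi * \<i> * (of_int j + 1 / 2)\<^sup>2 * \<tau>
        + 2 * of_real pi * \<i> * (of_int j + 1 / 2) * (z + 1 / 2)))"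

definition kronecker_phi :: "complex \<Rightarrow> complex \<Rightarrow> complex \<Rightarrow> complex" where
  "kronecker_phi \<tau> u z = theta \<tau> (u + z) * deriv (theta \<tau>) 0 / (theta \<tau> u * theta \<tau> z)"

definition varphi :: "nat \<Rightarrow> complex \<Rightarrow> complex \<Rightarrow> complex" where
  "varphi \<alpha> \<tau> z = exp (2 * of_real pi * \<i> * z * deriv (half_period \<alpha>) \<tau>)
     * kronecker_phi \<tau> z (half_period \<alpha> \<tau>)"

definition pauli :: "nat \<Rightarrow> complex^2^2" where
  "pauli \<alpha> =
     (if \<alpha> = 1 then vector [vector [0, 1], vector [1, 0]]
      else if \<alpha> = 2 then vector [vector [0, - \<i>], vector [\<i>, 0]]
      else if \<alpha> = 3 then vector [vector [1, 0], vector [0, - 1]]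
      else 0)"

definition cscale :: "complex \<Rightarrow> complex^2^2 \<Rightarrow> complex^2^2" (infixr \<open>*\<^sub>m\<close> 75) where
  "c *\<^sub>m A = (\<chi> i j. c * A $ i $ j)"

text \<open>The coordinate \<open>S\<^sup>a\<^sub>\<alpha>\<close> is \<open>S a \<alpha>\<close>.\<close>

definition lax :: "complex \<Rightarrow> (nat \<Rightarrow> nat \<Rightarrow> complex) \<Rightarrow> complex \<Rightarrow> complex^2^2" where
  "lax \<tau> S z =
     (\<Sum>a=0..3. \<Sum>\<alpha>=1..3. (S a \<alpha> * varphi \<alpha> \<tau> (z - half_period a \<tau>)) *\<^sub>m pauli \<alpha>)"

definition involution :: "(complex \<Rightarrow> complex^2^2) \<Rightarrow> complex \<Rightarrow> complex^2^2" where
  "involution L z = - L (- z)"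

definition plus_part :: "(complex \<Rightarrow> complex^2^2) \<Rightarrow> complex \<Rightarrow> complex^2^2" where
  "plus_part L z = (1 / 2) *\<^sub>m (L z + involution L z)"

definition minus_part :: "(complex \<Rightarrow> complex^2^2) \<Rightarrow> complex \<Rightarrow> complex^2^2" where
  "minus_part L z = (1 / 2) *\<^sub>m (L z - involution L z)"

text \<open>Functions here are total, with arbitrary values at poles (division by zero gives zero), so
  meromorphic matrix functions are identified when they agree off a set without
  accumulation points.\<close>

definition meromorphic_matrix :: "(complex \<Rightarrow> complex^2^2) \<Rightarrow> bool" where
  "meromorphic_matrix F \<longleftrightarrow> (\<forall>i j. (\<lambda>z. F z $ i $ j) meromorphic_on UNIV)"

definition mero_eq ::
    "(complex \<Rightarrow> complex^2^2) \<Rightarrow> (complex \<Rightarrow> complex^2^2) \<Rightarrow> bool" (infix \<open>\<cong>\<^sub>m\<close> 50) where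
  "F \<cong>\<^sub>m G \<longleftrightarrow> eventually (\<lambda>z. F z = G z) (cosparse UNIV)"

definition nu_tilde :: "(nat \<Rightarrow> nat \<Rightarrow> complex) \<Rightarrow> nat \<Rightarrow> complex" where
  "nu_tilde S \<alpha> = S \<alpha> \<alpha>"

definition nu_prime :: "complex \<Rightarrow> (nat \<Rightarrow> nat \<Rightarrow> complex) \<Rightarrow> nat \<Rightarrow> complex" where
  "nu_prime \<tau> S \<alpha> = - nu_tilde S \<alpha>
     * exp (- 2 * of_real pi * \<i> * half_period \<alpha> \<tau> * deriv (half_period \<alpha>) \<tau>)
     * (deriv (theta \<tau>) 0 / theta \<tau> (half_period \<alpha> \<tau>))\<^sup>2"

definition casimir :: "(nat \<Rightarrow> nat \<Rightarrow> complex) \<Rightarrow> nat \<Rightarrow> complex" where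
  "casimir S a = (\<Sum>\<beta>=1..3. (S a \<beta>)\<^sup>2)"

definition invariant_locus :: "complex \<Rightarrow> (nat \<Rightarrow> nat \<Rightarrow> complex) set" where
  "invariant_locus \<tau> = {S. minus_part (lax \<tau> S) \<cong>\<^sub>m (\<lambda>z. 0)}"

definition casimir_level :: "(nat \<Rightarrow> complex) \<Rightarrow> (nat \<Rightarrow> nat \<Rightarrow> complex) set" where
  "casimir_level c = {S. \<forall>a\<in>{0..3}. casimir S a = c a}"

end

theory Submission
  imports Defs
begin

text \<open>Each \<open>\<phi>\<^sub>\<alpha>\<close> is odd, and translation by \<open>2\<omega>\<^sub>a\<close> multiplies it by
  \<open>1\<close> if \<open>a \<in> {0, \<alpha>}\<close> and by \<open>-1\<close> otherwise. So \<open>L\<^sup>+\<close> collects the terms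
  with \<open>a \<in> {0, \<alpha>}\<close> and \<open>L\<^sup>-\<close> the others, and a residue at \<open>\<omega>\<^sub>b\<close> shows that
  \<open>L\<^sup>- \<equiv> 0\<close> forces \<open>S\<^sup>b\<^sub>\<alpha> = 0\<close> for \<open>b \<notin> {0, \<alpha>}\<close>. This needs that \<open>\<theta>\<close> does not
  vanish at the half-periods and has a simple zero at \<open>0\<close>. Both follow, without counting zeros
  by contour integrals, from the fact that an entire function with the quasi-periodicity of
  \<open>\<theta>\<close> is unique up to a scalar: this gives a duplication formula, whose two sides have the
  same order at \<open>0\<close>, and identifies the Wronskian of \<open>\<theta>(z)\<close> and \<open>\<theta>(z + 1/2)\<close> with a multiple
  of \<open>\<theta>(z + \<tau>/2) \<theta>(z + 1/2 + \<tau>/2)\<close> up to an exponential factor.\<close>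

section \<open>Fourier coefficients of entire periodic functions\<close>

lemma entire_compose:
  assumes "h holomorphic_on UNIV" and "f holomorphic_on A"
  shows "(\<lambda>z. h (f z)) holomorphic_on A"
  using holomorphic_on_compose[OF assms(2) holomorphic_on_subset[OF assms(1)]] by (simp add: o_def)

text \<open>With a primitive \<open>P\<close> of \<open>h\<close>, the shifted integral is P(w + 1)
  - P(w). Its derivative in w is h(w + 1) - h(w) = 0, so it does not depend on the complex number
  w.\<close>

lemma contour_integral_periodic_shift:
  fixes h :: "complex \<Rightarrow> complex"
  assumes hol: "h holomorphic_on UNIV" and per: "\<And>z. h (z + 1) = h z"
  shows "contour_integral (linepath 0 1) (\<lambda>z. h (z + w)) = contour_integral (linepath 0 1) h"
proof -
  obtain P where P: "\<And>z. (P has_field_derivative h z) (at z)"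
    using holomorphic_convex_primitive'[OF convex_UNIV open_UNIV hol] by auto
  have Pw: "((\<lambda>z. P (z + w)) has_field_derivative h (z + w)) (at z)" for z w
    using P DERIV_shift by blast
  have int: "contour_integral (linepath 0 1) (\<lambda>z. h (z + w)) = P (w + 1) - P w" for w
    using contour_integral_primitive[of UNIV "\<lambda>z. P (z + w)" "\<lambda>z. h (z + w)" "linepath 0 1"] Pw
    by (auto intro!: contour_integral_unique simp: add.commute)
  have "((\<lambda>w. P (w + 1) - P w) has_field_derivative 0) (at w)" for w
    using DERIV_diff[OF Pw[of 1 w] P[of w]] per by simp
  then have "(\<lambda>w. P (w + 1) - P w) constant_on UNIV"
    by (intro has_field_derivative_0_imp_constant_on) auto
  then have "P (w + 1) - P w = P (0 + 1) - P 0"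
    unfolding constant_on_def by (metis UNIV_I)
  then show ?thesis
    using int[of w] int[of 0] by simp
qed

definition fourier_coeff :: "(complex \<Rightarrow> complex) \<Rightarrow> int \<Rightarrow> complex" where
  "fourier_coeff h n = contour_integral (linepath 0 1) (\<lambda>z. h z * exp (- 2 * of_real pi * \<i> * of_int n * z))"

lemma exp_2pi_i_int_mult: "exp (2 * of_real pi * \<i> * of_int n) = (1 :: complex)"
  using exp_integer_2pi[of "of_int n"] by (simp add: mult_ac)

lemma exp_2pi_i_int_add_one:
  "exp (- 2 * of_real pi * \<i> * of_int n * (z + 1)) = exp (- 2 * of_real pi * \<i> * of_int n * z)"
  using exp_2pi_i_int_mult[of "- n"] by (simp add: ring_distribs exp_add exp_diff mult_ac exp_minus)

lemma fourier_integrable: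
  assumes "h holomorphic_on UNIV"
  shows "(\<lambda>z. h z * exp (- 2 * of_real pi * \<i> * of_int n * z)) contour_integrable_on linepath a b"
  by (intro contour_integrable_continuous_linepath holomorphic_on_imp_continuous_on
      holomorphic_intros holomorphic_on_subset[OF assms]) auto

text \<open>Shifting both factors of the integrand leaves the integral unchanged, and the
  exponential contributes a constant that can be pulled out. Complex shifts are allowed: imaginary
  ones give decay of the coefficients, the shift by \<tau> gives a recursion.\<close>

lemma fourier_coeff_shift:
  assumes hol: "h holomorphic_on UNIV" and per: "\<And>z. h (z + 1) = h z"
  shows "fourier_coeff (\<lambda>z. h (z + w)) n = exp (2 * of_real pi * \<i> * of_int n * w) * fourier_coeff h n"
proof -
  let ?e = "\<lambda>z. exp (- 2 * of_real pi * \<i> * of_int n * z)"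
  have "contour_integral (linepath 0 1) (\<lambda>z. h (z + w) * ?e (z + w)) = fourier_coeff h n"
    unfolding fourier_coeff_def
    by (rule contour_integral_periodic_shift[of "\<lambda>z. h z * ?e z"])
       (auto intro!: holomorphic_intros holomorphic_on_subset[OF hol]
             simp only: per exp_2pi_i_int_add_one)
  moreover have "h (z + w) * ?e (z + w) = ?e w * (h (z + w) * ?e z)" for z
    by (simp add: ring_distribs exp_add exp_diff exp_minus field_simps)
  moreover have "(\<lambda>z. h (z + w)) holomorphic_on UNIV"
    by (intro entire_compose[OF hol] holomorphic_intros)
  then have "contour_integral (linepath 0 1) (\<lambda>z. ?e w * (h (z + w) * ?e z)) =
      ?e w * fourier_coeff (\<lambda>z. h (z + w)) n"
    unfolding fourier_coeff_def by (intro contour_integral_lmul fourier_integrable)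
  ultimately have "?e w * fourier_coeff (\<lambda>z. h (z + w)) n = fourier_coeff h n"
    by (simp only:)
  then show ?thesis
    by (auto simp: exp_minus field_simps)
qed

text \<open>Moving the segment by one unit along the imaginary axis, in the direction chosen by
  \<open>s\<close>, multiplies the coefficient by exp(2 pi n). The moved coefficients stay bounded
  by the maximum of \<open>h\<close> on the moved segment, so the original ones decay
  geometrically.\<close>

lemma fourier_coeff_tendsto_0:
  assumes hol: "h holomorphic_on UNIV" and per: "\<And>z. h (z + 1) = h z"
    and s: "s = 1 \<or> s = - 1"
  shows "(\<lambda>n. fourier_coeff h (s * int n)) \<longlonglongrightarrow> 0"
proof -
  let ?f = "\<lambda>z. h (z - s * \<i>)"
  have hol': "?f holomorphic_on UNIV"
    by (intro entire_compose[OF hol] holomorphic_intros)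
  have "compact (?f ` closed_segment 0 1)"
    by (intro compact_continuous_image holomorphic_on_imp_continuous_on holomorphic_on_subset[OF hol']) auto
  then obtain M where M: "\<And>z. z \<in> closed_segment 0 1 \<Longrightarrow> norm (?f z) \<le> M" and "M > 0"
    using compact_imp_bounded[of "?f ` closed_segment 0 1"] by (auto simp: bounded_pos)
  have bound: "norm (fourier_coeff ?f (s * int n)) \<le> M" for n
  proof -
    have "norm (fourier_coeff ?f (s * int n)) \<le> M * norm (1 - 0 :: complex)"
      unfolding fourier_coeff_def
    proof (rule contour_integral_bound_linepath[OF fourier_integrable[OF hol']])
      fix z :: complex assume z: "z \<in> closed_segment 0 1"
      then obtain u :: real where "z = of_real u"
        by (auto simp: closed_segment_def scaleR_conv_of_real)
      then show "norm (?f z * exp (- 2 * of_real pi * \<i> * of_int (s * int n) * z)) \<le> M"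
        using M[OF z] by (simp add: norm_mult)
    qed (use \<open>M > 0\<close> in auto)
    then show ?thesis by simp
  qed
  have shift: "fourier_coeff ?f (s * int n) = of_real (exp (2 * pi * real n)) * fourier_coeff h (s * int n)" for n
  proof -
    have "2 * of_real pi * \<i> * of_int (s * int n) * (- (s * \<i>)) = of_real (2 * pi * real n)"
      using s by (auto simp: mult_ac)
    then show ?thesis
      using fourier_coeff_shift[OF hol per, of "- (s * \<i>)" "s * int n"]
      by (simp only: exp_of_real) simp
  qed
  have "norm (fourier_coeff h (s * int n)) \<le> M * exp (- (2 * pi)) ^ n" for n
    using bound[of n] unfolding shift
    by (simp add: norm_mult exp_minus field_simps flip: exp_of_nat_mult)
  then have "\<forall>\<^sub>F n in sequentially. norm (fourier_coeff h (s * int n)) \<le> M * exp (- (2 * pi)) ^ n"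
    by simp
  moreover have "norm (exp (- (2 * pi))) < 1"
    by simp
  then have "(\<lambda>n. M * exp (- (2 * pi)) ^ n) \<longlonglongrightarrow> 0"
    by (intro tendsto_mult_right_zero LIMSEQ_power_zero)
  ultimately show ?thesis
    by (rule Lim_null_comparison)
qed

text \<open>The denominator exp(2 pi i z) - 1 has simple zeros, exactly at the integers, and by
  periodicity the numerator vanishes there as well, so all singularities of the quotient are
  removable.\<close>

lemma entire_periodic_divided_difference:
  assumes hol: "h holomorphic_on UNIV" and per: "\<And>z. h (z + 1) = h z"
  obtains g where "g holomorphic_on UNIV" "\<And>z. g (z + 1) = g z"
    "\<And>z. h z - h 0 = (exp (2 * of_real pi * \<i> * z) - 1) * g z"
proof -
  let ?e = "\<lambda>z. exp (2 * of_real pi * \<i> * z) - 1 :: complex"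
  have e0: "?e z = 0 \<longleftrightarrow> z \<in> \<int>" for z
  proof
    assume "?e z = 0"
    then have "exp (2 * of_real pi * \<i> * z) = exp 0" by simp
    then obtain n :: int where "2 * of_real pi * \<i> * z = 0 + of_int (2 * n) * pi * \<i>"
      unfolding exp_eq by blast
    then show "z \<in> \<int>" by simp
  qed (auto elim!: Ints_cases simp: exp_2pi_i_int_mult)
  \<comment> \<open>The value at the integers is the limit given by l'Hopital's rule; it is the same
    at each of them because \<open>deriv h\<close> also has period 1.\<close>
  define g where "g z = (if z \<in> \<int> then deriv h 0 / (2 * of_real pi * \<i>) else (h z - h 0) / ?e z)" for z
  have Int_add: "z + 1 \<in> \<int> \<longleftrightarrow> z \<in> \<int>" for z :: complex
    by (metis Ints_1 Ints_add Ints_diff add_diff_cancel_right')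
  have gper: "g (z + 1) = g z" for z
    using per by (simp add: g_def Int_add ring_distribs exp_add)
  have hn: "h (of_int n) = h 0" for n :: int
  proof (induction n rule: int_induct[where k = 0])
    case (step1 i) then show ?case using per[of "of_int i"] by simp
  next
    case (step2 i) then show ?case using per[of "of_int (i - 1)"] by simp
  qed simp
  have eq: "h z - h 0 = ?e z * g z" for z
    using e0[of z] hn by (auto simp: g_def elim!: Ints_cases)
  have dh: "(h has_field_derivative deriv h z) (at z)" for z
    using holomorphic_derivI[OF hol] by auto
  have hper_deriv: "deriv h (of_int n) = deriv h 0" for n :: int
  proof -
    have per_n: "h (z + of_int n) = h z" for z
    proof (induction n rule: int_induct[where k = 0])
      case (step1 i) then show ?case using per[of "z + of_int i"] by (simp add: add_ac)
    next
      case (step2 i) then show ?case using per[of "z + of_int (i - 1)"] by (simp add: algebra_simps)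
    qed simp
    have "((\<lambda>z. h (z + of_int n)) has_field_derivative deriv h (0 + of_int n)) (at 0)"
      using dh DERIV_shift by blast
    then show ?thesis
      using dh[of 0] by (simp add: per_n DERIV_unique)
  qed
  have not_Int: "w \<notin> \<int>" if "w \<in> ball (of_int n) 1 - {of_int n}" for w :: complex and n
  proof
    assume "w \<in> \<int>"
    then obtain m where w: "w = of_int m" by (auto elim: Ints_cases)
    then have "dist (of_int n) w = real_of_int \<bar>n - m\<bar>"
      by (simp add: dist_norm flip: of_int_diff)
    then show False using that by (auto simp: w)
  qed
  have quot: "(\<lambda>z. (h z - h 0) / ?e z) holomorphic_on A" if "A \<subseteq> - \<int>" for A
    using e0 that by (intro holomorphic_intros holomorphic_on_subset[OF hol]) auto
  have g_quot: "g holomorphic_on A" if "A \<subseteq> - \<int>" for A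
    using quot[OF that] by (rule holomorphic_transform) (use that in \<open>auto simp: g_def\<close>)
  \<comment> \<open>The unit ball around an integer contains no other integer, so one puncture has
    to be filled.\<close>
  have "g holomorphic_on ball (of_int n) 1" for n
  proof (rule no_isolated_singularity'[where K = "{of_int n}"])
    show "g holomorphic_on ball (of_int n) 1 - {of_int n}"
      using not_Int by (intro g_quot) auto
    fix x :: complex assume "x \<in> {of_int n}"
    then have x: "x = of_int n" by simp
    have "((\<lambda>w. (h w - h 0) / ?e w) \<longlongrightarrow> g x) (at x)"
    proof (rule lhopital_complex_simple)
      show "((\<lambda>w. h w - h 0) has_field_derivative deriv h x) (at x)"
        using DERIV_diff[OF dh DERIV_const] by simp
      show "(?e has_field_derivative 2 * of_real pi * \<i>) (at x)"
        unfolding x by (auto intro!: derivative_eq_intros simp: exp_2pi_i_int_mult)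
    qed (auto simp: x hn hper_deriv g_def exp_2pi_i_int_mult)
    moreover have "eventually (\<lambda>w. w \<in> ball x 1 - {x}) (at x)"
      by (rule eventually_at_in_open) auto
    then have "eventually (\<lambda>w. (h w - h 0) / ?e w = g w) (at x)"
      by eventually_elim (use not_Int x in \<open>auto simp: g_def\<close>)
    ultimately have "(g \<longlongrightarrow> g x) (at x)"
      by (rule Lim_transform_eventually)
    then show "(g \<longlongrightarrow> g x) (at x within ball (of_int n) 1)"
      by (rule tendsto_within_subset) auto
  qed auto
  then have "g holomorphic_on - \<int> \<union> (\<Union>n. ball (of_int n) 1)"
    by (intro holomorphic_on_Un holomorphic_on_UN_open open_UN open_Compl closed_Ints ballI g_quot[of "- \<int>"])
       auto
  moreover have "- \<int> \<union> (\<Union>n. ball (of_int n) 1) = (UNIV :: complex set)"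
    by (force elim!: Ints_cases intro: centre_in_ball[THEN iffD2])
  ultimately have "g holomorphic_on UNIV"
    by simp
  then show thesis
    using gper eq by (rule that)
qed

lemma fourier_coeff_const: "fourier_coeff (\<lambda>_. c) n = (if n = 0 then c else 0)"
proof (cases "n = 0")
  case False
  let ?w = "- 2 * of_real pi * \<i> * of_int n :: complex"
  have "((\<lambda>z. c * exp (?w * z) / ?w) has_field_derivative c * exp (?w * z)) (at z)" for z
    using False by (auto intro!: derivative_eq_intros)
  then have "((\<lambda>z. c * exp (?w * z)) has_contour_integral
      c * exp (?w * 1) / ?w - c * exp (?w * 0) / ?w) (linepath 0 1)"
    using contour_integral_primitive[of UNIV "\<lambda>z. c * exp (?w * z) / ?w" "\<lambda>z. c * exp (?w * z)" "linepath 0 1"]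
    by auto
  moreover have "exp (?w * 1) = 1"
    using exp_2pi_i_int_mult[of "- n"] by simp
  ultimately show ?thesis
    using False contour_integral_unique by (fastforce simp: fourier_coeff_def)
qed (simp add: fourier_coeff_def)

text \<open>Chernoff's argument: if \<open>h - h 0 = (e\<^sup>2\<^sup>\<pi>\<^sup>i\<^sup>z - 1) g\<close>, the Fourier
  coefficients of \<open>h - h 0\<close> telescope in those of \<open>g\<close>, which decay in both directions.\<close>

lemma entire_periodic_fourier_zero_at_0:
  assumes hol: "h holomorphic_on UNIV" and per: "\<And>z. h (z + 1) = h z"
    and zero: "\<And>n. fourier_coeff h n = 0"
  shows "h 0 = 0"
proof -
  obtain g where g: "g holomorphic_on UNIV" "\<And>z. g (z + 1) = g z"
    and eq: "\<And>z. h z - h 0 = (exp (2 * of_real pi * \<i> * z) - 1) * g z"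
    using entire_periodic_divided_difference[OF hol per] by metis
  have step: "fourier_coeff g (n - 1) - fourier_coeff g n = - (if n = 0 then h 0 else 0)" for n
  proof -
    let ?e = "\<lambda>n z. exp (- 2 * of_real pi * \<i> * of_int n * z) :: complex"
    have "fourier_coeff g (n - 1) - fourier_coeff g n =
        contour_integral (linepath 0 1) (\<lambda>z. g z * ?e (n - 1) z - g z * ?e n z)"
      unfolding fourier_coeff_def by (intro contour_integral_diff[symmetric] fourier_integrable g)
    also have "(\<lambda>z. g z * ?e (n - 1) z - g z * ?e n z) = (\<lambda>z. h z * ?e n z - h 0 * ?e n z)"
    proof
      fix z
      have "?e (n - 1) z = exp (2 * of_real pi * \<i> * z) * ?e n z"
        by (simp add: algebra_simps flip: exp_add)
      then have "g z * ?e (n - 1) z - g z * ?e n z = (exp (2 * of_real pi * \<i> * z) - 1) * g z * ?e n z"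
        by (simp only: left_diff_distrib mult_1 mult.assoc mult.left_commute)
      also have "\<dots> = h z * ?e n z - h 0 * ?e n z"
        by (simp only: eq[symmetric] left_diff_distrib[of "h z"])
      finally show "g z * ?e (n - 1) z - g z * ?e n z = h z * ?e n z - h 0 * ?e n z" .
    qed
    also have "contour_integral (linepath 0 1) \<dots> = fourier_coeff h n - fourier_coeff (\<lambda>_. h 0) n"
      unfolding fourier_coeff_def
      by (intro contour_integral_diff fourier_integrable hol holomorphic_on_const)
    finally show ?thesis
      by (simp add: zero fourier_coeff_const)
  qed
  \<comment> \<open>By \<open>step\<close> the coefficients of \<open>g\<close> are constant on n
    \<ge> 0 and on n \<le> -1, with a jump of size \<open>h 0\<close> between the two ranges. Decay
    makes both constants 0.\<close>
  have "fourier_coeff g (int n) = fourier_coeff g 0" for n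
  proof (induction n)
    case (Suc n)
    then show ?case using step[of "int n + 1"] by (simp add: add.commute)
  qed simp
  then have "fourier_coeff g 0 = 0"
    using fourier_coeff_tendsto_0[OF g, of 1] by (simp add: LIMSEQ_const_iff)
  have "fourier_coeff g (- 1 - int n) = fourier_coeff g (- 1)" for n
  proof (induction n)
    case (Suc n)
    then show ?case using step[of "- 1 - int n"] by (simp add: algebra_simps)
  qed simp
  \<comment> \<open>The index 0 belongs to the other range, so the sequence running to minus
    infinity is taken from its second term on.\<close>
  then have "fourier_coeff g (- 1 * int (Suc n)) = fourier_coeff g (- 1)" for n
    by (simp add: algebra_simps)
  then have "fourier_coeff g (- 1) = 0"
    using LIMSEQ_Suc[OF fourier_coeff_tendsto_0[OF g, of "- 1"]] by (simp add: LIMSEQ_const_iff del: of_nat_Suc)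
  then show ?thesis
    using step[of 0] \<open>fourier_coeff g 0 = 0\<close> by simp
qed

text \<open>By the shift rule all coefficients of every translate vanish too, which moves an
  arbitrary point to 0.\<close>

lemma entire_periodic_fourier_zero:
  assumes hol: "h holomorphic_on UNIV" and per: "\<And>z. h (z + 1) = h z"
    and zero: "\<And>n. fourier_coeff h n = 0"
  shows "h w = 0"
proof -
  have "(\<lambda>z. h (z + w)) holomorphic_on UNIV"
    by (intro entire_compose[OF hol] holomorphic_intros)
  moreover have "h (z + 1 + w) = h (z + w)" for z
    using per[of "z + w"] by (simp add: add_ac)
  ultimately have "h (0 + w) = 0"
    using entire_periodic_fourier_zero_at_0[of "\<lambda>z. h (z + w)"] fourier_coeff_shift[OF hol per] zero
    by simp
  then show ?thesis by simp
qed

section \<open>Uniqueness of entire functions with theta-type quasi-periodicity\<close>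

lemma quasiperiodic_zero:
  assumes hol: "h holomorphic_on UNIV" and per: "\<And>z. h (z + 1) = h z"
    and quasi: "\<And>z. h (z + \<tau>) = b * exp (- 2 * of_real pi * \<i> * z) * h z" and "b \<noteq> 0"
    and zero: "fourier_coeff h 0 = 0"
  shows "h z = 0"
proof (rule entire_periodic_fourier_zero[OF hol per])
  \<comment> \<open>Comparing coefficients in the quasi-periodicity relation gives a two-term
    recursion. It carries the vanishing of the coefficient at 0 upwards because \<open>b\<close> is
    nonzero, and downwards because the exponential is nonzero.\<close>
  have step: "exp (2 * of_real pi * \<i> * of_int n * \<tau>) * fourier_coeff h n = b * fourier_coeff h (n + 1)" for n
  proof -
    have "(\<lambda>z. h (z + \<tau>) * exp (- 2 * of_real pi * \<i> * of_int n * z)) =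
        (\<lambda>z. b * (h z * exp (- 2 * of_real pi * \<i> * of_int (n + 1) * z)))"
      by (simp add: quasi fun_eq_iff algebra_simps flip: exp_add)
    then show ?thesis
      by (simp only: fourier_coeff_shift[OF hol per, symmetric])
         (simp only: fourier_coeff_def contour_integral_lmul[OF fourier_integrable[OF hol]])
  qed
  show "fourier_coeff h n = 0" for n
  proof (induction n rule: int_induct[where k = 0])
    case (step1 i)
    then show ?case using step[of i] \<open>b \<noteq> 0\<close> by simp
  next
    case (step2 i)
    then show ?case using step[of "i - 1"] by simp
  qed (rule zero)
qed

text \<open>The factor exp(- Ln a * z) makes the functions 1-periodic and keeps the shape of the
  second relation. By \<open>quasiperiodic_zero\<close> such a function is determined by one linear
  functional \<open>c\<close>, and \<open>k\<close> is chosen so that \<open>c\<close> vanishes on F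
  - k G.\<close>

lemma quasiperiodic_unique:
  assumes F: "F holomorphic_on UNIV" "\<And>z. F (z + 1) = a * F z"
      "\<And>z. F (z + \<tau>) = b * exp (- 2 * of_real pi * \<i> * z) * F z"
    and G: "G holomorphic_on UNIV" "\<And>z. G (z + 1) = a * G z"
      "\<And>z. G (z + \<tau>) = b * exp (- 2 * of_real pi * \<i> * z) * G z"
    and ab: "a \<noteq> 0" "b \<noteq> 0" and "G w \<noteq> 0"
  shows "\<exists>k. \<forall>z. F z = k * G z"
proof -
  let ?e = "\<lambda>z. exp (- Ln a * z)"
  define c where "c H = fourier_coeff (\<lambda>z. ?e z * H z) 0" for H
  have *: "H z = 0" if H: "H holomorphic_on UNIV" "\<And>z. H (z + 1) = a * H z"
      "\<And>z. H (z + \<tau>) = b * exp (- 2 * of_real pi * \<i> * z) * H z" "c H = 0" for H z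
  proof -
    have "?e z * H z = 0"
    proof (rule quasiperiodic_zero[where h = "\<lambda>z. ?e z * H z" and \<tau> = \<tau> and b = "?e \<tau> * b"])
      show "(\<lambda>z. ?e z * H z) holomorphic_on UNIV"
        by (intro holomorphic_intros H)
      have "?e (z + 1) = ?e z / a" for z
        using ab by (simp add: ring_distribs exp_diff)
      then show "?e (z + 1) * H (z + 1) = ?e z * H z" for z
        using ab by (simp only: H(2)) simp
      show "?e (z + \<tau>) * H (z + \<tau>) = (?e \<tau> * b) * exp (- 2 * of_real pi * \<i> * z) * (?e z * H z)" for z
        unfolding H(3) by (simp add: ring_distribs exp_add exp_diff exp_minus field_simps)
    qed (use ab H in \<open>auto simp: c_def\<close>)
    then show ?thesis by simp
  qed
  have "c G \<noteq> 0"
    using *[OF G] \<open>G w \<noteq> 0\<close> by blast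
  define k where "k = c F / c G"
  have "F z - k * G z = 0" for z
  proof (rule *[where H = "\<lambda>z. F z - k * G z"])
    have int: "(\<lambda>z. ?e z * H z) contour_integrable_on linepath 0 1" if "H holomorphic_on UNIV" for H
      by (intro contour_integrable_continuous_linepath holomorphic_on_imp_continuous_on
          holomorphic_intros holomorphic_on_subset[OF that]) auto
    have "c (\<lambda>z. F z - k * G z) = contour_integral (linepath 0 1) (\<lambda>z. ?e z * F z - k * (?e z * G z))"
      by (simp add: c_def fourier_coeff_def algebra_simps)
    also have "\<dots> = c F - k * c G"
      using int F(1) G(1)
      by (simp add: c_def fourier_coeff_def contour_integral_diff contour_integrable_lmul contour_integral_lmul)
    finally show "c (\<lambda>z. F z - k * G z) = 0"
      using \<open>c G \<noteq> 0\<close> by (simp add: k_def)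
    show "(\<lambda>z. F z - k * G z) holomorphic_on UNIV"
      by (intro holomorphic_intros F G)
  qed (simp_all only: F G right_diff_distrib mult.left_commute)
  then show ?thesis
    by (intro exI[of _ k]) simp
qed

section \<open>The odd theta function\<close>

definition theta_term :: "complex \<Rightarrow> complex \<Rightarrow> int \<Rightarrow> complex" where
  "theta_term \<tau> z j = exp (of_real pi * \<i> * (of_int j + 1 / 2)\<^sup>2 * \<tau>
     + 2 * of_real pi * \<i> * (of_int j + 1 / 2) * (z + 1 / 2))"

lemma theta_eq_infsum: "theta \<tau> z = (\<Sum>\<^sub>\<infinity>j. theta_term \<tau> z j)"
  by (simp add: theta_def theta_term_def)

lemma exp_half_odd: "exp (2 * of_real pi * \<i> * (of_int j + 1 / 2)) = (- 1 :: complex)"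
  using exp_2pi_i_int_mult[of j] by (simp add: ring_distribs exp_add)

lemma theta_add_one: "theta \<tau> (z + 1) = - theta \<tau> z"
proof -
  have "theta_term \<tau> (z + 1) j = - theta_term \<tau> z j" for j
  proof -
    have "theta_term \<tau> (z + 1) j = theta_term \<tau> z j * exp (2 * of_real pi * \<i> * (of_int j + 1 / 2))"
      unfolding theta_term_def by (subst exp_add[symmetric]) (simp add: algebra_simps)
    then show ?thesis by (simp add: exp_half_odd)
  qed
  then show ?thesis
    by (simp add: theta_eq_infsum infsum_uminus)
qed

text \<open>Completing the square, (j + 1/2)^2 + 2 (j + 1/2) = (j + 3/2)^2 - 1, so the shift by
  \<tau> reindexes the series by j + 1. The minus sign is exp(- pi i) and comes from the offset in z
  + 1/2.\<close>

lemma theta_add_tau: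
  "theta \<tau> (z + \<tau>) = - exp (- of_real pi * \<i> * \<tau>) * exp (- 2 * of_real pi * \<i> * z) * theta \<tau> z"
proof -
  have "theta_term \<tau> (z + \<tau>) = (\<lambda>j. (- exp (- of_real pi * \<i> * \<tau>) * exp (- 2 * of_real pi * \<i> * z)) * theta_term \<tau> z (j + 1))"
  proof
    fix j
    have "theta_term \<tau> (z + \<tau>) j =
      exp (- of_real pi * \<i>) * exp (- of_real pi * \<i> * \<tau>) * exp (- 2 * of_real pi * \<i> * z) * theta_term \<tau> z (j + 1)"
      unfolding theta_term_def exp_add[symmetric]
      by (rule arg_cong[of _ _ exp]) (simp add: field_simps power2_eq_square)
    then show "theta_term \<tau> (z + \<tau>) j =
        (- exp (- of_real pi * \<i> * \<tau>) * exp (- 2 * of_real pi * \<i> * z)) * theta_term \<tau> z (j + 1)"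
      by (simp add: exp_minus)
  qed
  moreover have "(\<Sum>\<^sub>\<infinity>j. theta_term \<tau> z (j + 1)) = theta \<tau> z"
    unfolding theta_eq_infsum
    by (rule infsum_reindex_bij_witness[where i = "\<lambda>j. j - 1" and j = "\<lambda>j. j + 1"]) auto
  ultimately show ?thesis
    unfolding theta_eq_infsum[of \<tau> "z + \<tau>"] by (simp add: infsum_uminus infsum_cmult_right')
qed

text \<open>The substitution of -1 - j for j negates j + 1/2. The offset in z + 1/2 then leaves the
  factor exp(2 pi i (j + 1/2)) = -1 in every term.\<close>

lemma theta_minus: "theta \<tau> (- z) = - theta \<tau> z"
proof -
  have "theta_term \<tau> (- z) = (\<lambda>j. - theta_term \<tau> z (- 1 - j))"
  proof
    fix j
    have "theta_term \<tau> (- z) j = theta_term \<tau> z (- 1 - j) * exp (2 * of_real pi * \<i> * (of_int j + 1 / 2))"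
      unfolding theta_term_def exp_add[symmetric]
      by (rule arg_cong[of _ _ exp]) (simp add: field_simps power2_eq_square)
    then show "theta_term \<tau> (- z) j = - theta_term \<tau> z (- 1 - j)"
      by (simp add: exp_half_odd)
  qed
  moreover have "(\<Sum>\<^sub>\<infinity>j. theta_term \<tau> z (- 1 - j)) = theta \<tau> z"
    unfolding theta_eq_infsum
    by (rule infsum_reindex_bij_witness[where i = "\<lambda>j. - 1 - j" and j = "\<lambda>j. - 1 - j"]) auto
  ultimately show ?thesis
    unfolding theta_eq_infsum[of \<tau> "- z"] by (simp add: infsum_uminus)
qed

lemma theta_0: "theta \<tau> 0 = 0"
  using theta_minus[of \<tau> 0] by simp

text \<open>The Gaussian factor beats the exponential growth in Im z on a disc. The resulting
  majorant does not depend on z, as the Weierstrass M-test requires.\<close>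

lemma theta_term_bound:
  assumes "Im \<tau> > 0"
  obtains C where "\<And>z j. norm z \<le> R \<Longrightarrow> norm (theta_term \<tau> z j) \<le> C * exp (- real_of_int \<bar>j\<bar>)"
proof -
  define A where "A = pi * Im \<tau>"
  \<comment> \<open>The extra summand 1 leaves -\<bar>m\<bar> over after completing the
    square.\<close>
  define B where "B = 2 * pi * \<bar>R\<bar> + 1"
  have "A > 0" using assms by (simp add: A_def)
  have "norm (theta_term \<tau> z j) \<le> exp (B\<^sup>2 / (4 * A) + 1) * exp (- real_of_int \<bar>j\<bar>)" if "norm z \<le> R" for z j
  proof -
    define m where "m = real_of_int j + 1 / 2"
    have "\<bar>Im z\<bar> \<le> \<bar>R\<bar>"
      using abs_Im_le_cmod[of z] that by linarith
    then have "\<bar>m * Im z\<bar> \<le> \<bar>m\<bar> * \<bar>R\<bar>"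
      by (simp only: abs_mult mult_left_mono abs_ge_zero)
    then have "- (m * Im z) \<le> \<bar>m\<bar> * \<bar>R\<bar>"
      using abs_ge_minus_self[of "m * Im z"] by (rule order_trans[rotated])
    then have 1: "- (2 * pi * (m * Im z)) \<le> 2 * pi * (\<bar>m\<bar> * \<bar>R\<bar>)"
      using mult_left_mono[of "- (m * Im z)" "\<bar>m\<bar> * \<bar>R\<bar>" "2 * pi"] by simp
    have "0 \<le> (2 * A * \<bar>m\<bar> - B)\<^sup>2 / (4 * A)"
      using \<open>A > 0\<close> by simp
    also have "\<dots> = A * m\<^sup>2 - B * \<bar>m\<bar> + B\<^sup>2 / (4 * A)"
      using \<open>A > 0\<close> unfolding power2_abs[of m, symmetric] by (simp add: power2_eq_square field_simps)
    finally have "- (A * m\<^sup>2) + 2 * pi * (\<bar>m\<bar> * \<bar>R\<bar>) \<le> B\<^sup>2 / (4 * A) - \<bar>m\<bar>"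
      by (simp add: B_def algebra_simps)
    moreover have "\<bar>real_of_int j\<bar> \<le> \<bar>m\<bar> + 1"
      by (simp add: m_def)
    \<comment> \<open>The estimates are combined linearly, with the nonlinear expressions replaced
      by variables.\<close>
    moreover have "x - y \<le> w + 1 - v" if "x + u \<le> w - t" "v \<le> t + 1" "- y \<le> u" for x y u w t v :: real
      using that by linarith
    ultimately have 2: "- (A * m\<^sup>2) - 2 * pi * (m * Im z) \<le> B\<^sup>2 / (4 * A) + 1 - \<bar>real_of_int j\<bar>"
      using 1 by blast
    have "Re (of_real pi * \<i> * (of_int j + 1 / 2)\<^sup>2 * \<tau> + 2 * of_real pi * \<i> * (of_int j + 1 / 2) * (z + 1 / 2)) =
        - (A * m\<^sup>2) - 2 * pi * (m * Im z)"
    proof -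
      have m: "(of_int j + 1 / 2 :: complex) = of_real m" by (simp add: m_def)
      show ?thesis
        unfolding m of_real_power[symmetric] by (simp add: A_def)
    qed
    with 2 show ?thesis
      by (simp add: theta_term_def flip: exp_add)
  qed
  then show thesis by (rule that)
qed

lemma summable_exp_minus_abs_int: "(\<lambda>j. C * exp (- real_of_int \<bar>j\<bar>)) summable_on (UNIV :: int set)"
proof (rule summable_on_cmult_right)
  let ?f = "\<lambda>j. exp (- real_of_int \<bar>j\<bar>)"
  have "summable (\<lambda>n. exp (- 1 :: real) ^ n)"
    by (intro summable_geometric) simp
  then have s: "(\<lambda>n. exp (- real n)) summable_on (UNIV :: nat set)"
    by (intro norm_summable_imp_summable_on) (simp flip: exp_of_nat_mult)
  have "?f summable_on range int"
    by (subst summable_on_reindex) (use s in \<open>auto simp: o_def\<close>)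
  moreover have "?f summable_on range (\<lambda>n. - int n)"
    by (subst summable_on_reindex) (use s in \<open>auto simp: o_def inj_on_def\<close>)
  ultimately have "?f summable_on (range int \<union> range (\<lambda>n. - int n))"
    by (rule summable_on_union)
  moreover have "range int \<union> range (\<lambda>n. - int n) = UNIV"
    by (auto intro: int_cases2)
  ultimately show "?f summable_on UNIV" by simp
qed

section \<open>Theta as an entire function, not identically zero\<close>

lemma theta_uniform_limit:
  assumes "Im \<tau> > 0" "bounded A"
  shows "uniform_limit A (\<lambda>X z. \<Sum>j\<in>X. theta_term \<tau> z j) (theta \<tau>) (finite_subsets_at_top UNIV)"
proof -
  obtain R where R: "\<And>z. z \<in> A \<Longrightarrow> norm z \<le> R"
    using assms(2) by (auto simp: bounded_iff)
  obtain C where "\<And>z j. norm z \<le> R \<Longrightarrow> norm (theta_term \<tau> z j) \<le> C * exp (- real_of_int \<bar>j\<bar>)"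
    using theta_term_bound[OF assms(1)] by metis
  then show ?thesis
    unfolding theta_eq_infsum[abs_def] using R
    by (intro Weierstrass_m_test_general[OF _ summable_exp_minus_abs_int]) auto
qed

lemma holomorphic_theta_term: "(\<lambda>z. theta_term \<tau> z j) holomorphic_on A"
  unfolding theta_term_def by (intro holomorphic_intros)

lemma holomorphic_theta:
  assumes "Im \<tau> > 0"
  shows "theta \<tau> holomorphic_on UNIV"
proof -
  have "theta \<tau> holomorphic_on ball z 1" for z
  proof (rule holomorphic_uniform_limit)
    show "uniform_limit (cball z 1) (\<lambda>X z. \<Sum>j\<in>X. theta_term \<tau> z j) (theta \<tau>) (finite_subsets_at_top UNIV)"
      by (intro theta_uniform_limit assms) auto
    show "\<forall>\<^sub>F X in finite_subsets_at_top UNIV. continuous_on (cball z 1) (\<lambda>z. \<Sum>j\<in>X. theta_term \<tau> z j) \<and>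
        (\<lambda>z. \<Sum>j\<in>X. theta_term \<tau> z j) holomorphic_on ball z 1"
      by (intro always_eventually allI conjI holomorphic_on_imp_continuous_on holomorphic_on_sum
          holomorphic_theta_term)
  qed auto
  then have "theta \<tau> holomorphic_on (\<Union>z. ball z 1)"
    by (intro holomorphic_on_UN_open) auto
  moreover have "(\<Union>z::complex. ball z 1) = UNIV"
    by (auto intro: centre_in_ball[THEN iffD2])
  ultimately show ?thesis by simp
qed

lemma fourier_coeff_exp:
  "fourier_coeff (\<lambda>z. c * exp (2 * of_real pi * \<i> * of_int k * z)) n = (if k = n then c else 0)"
proof -
  have "(\<lambda>z. c * exp (2 * of_real pi * \<i> * of_int k * z) * exp (- 2 * of_real pi * \<i> * of_int n * z)) =
      (\<lambda>z. c * exp (- 2 * of_real pi * \<i> * of_int (n - k) * z))"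
    by (simp add: fun_eq_iff algebra_simps flip: exp_add)
  then show ?thesis
    using fourier_coeff_const[of c "n - k"] by (auto simp: fourier_coeff_def)
qed

text \<open>The series is integrated termwise over [0, 1]. By orthogonality only the term j = 0
  survives, and its coefficient is an exponential, hence nonzero.\<close>

lemma theta_not_identically_zero:
  assumes "Im \<tau> > 0"
  shows "\<exists>z. theta \<tau> z \<noteq> 0"
proof (rule ccontr)
  assume "\<not> ?thesis"
  then have zero: "theta \<tau> = (\<lambda>_. 0)" by auto
  \<comment> \<open>This factor turns the frequencies j + 1/2 into the integers j.\<close>
  let ?e = "\<lambda>z. exp (- of_real pi * \<i> * z)"
  let ?S = "\<lambda>X z. \<Sum>j\<in>X. theta_term \<tau> z j * ?e z"
  define a where "a j = exp (of_real pi * \<i> * (of_int j + 1 / 2)\<^sup>2 * \<tau> + of_real pi * \<i> * (of_int j + 1 / 2))" for j :: int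
  have term_eq: "theta_term \<tau> z j * ?e z = a j * exp (2 * of_real pi * \<i> * of_int j * z)" for z j
    unfolding theta_term_def a_def exp_add[symmetric]
    by (rule arg_cong[of _ _ exp]) (simp add: algebra_simps)
  have int: "(\<lambda>z. theta_term \<tau> z j * ?e z) contour_integrable_on linepath 0 1" for j
    unfolding theta_term_def by (intro contour_integrable_continuous_linepath continuous_intros)
  have term_int: "contour_integral (linepath 0 1) (\<lambda>z. theta_term \<tau> z j * ?e z) = (if j = 0 then a 0 else 0)" for j
    using fourier_coeff_exp[of "a j" j 0] unfolding term_eq by (auto simp: fourier_coeff_def)
  have "uniform_limit (closed_segment 0 1) ?S (\<lambda>z. theta \<tau> z * ?e z) (finite_subsets_at_top UNIV)"
    unfolding sum_distrib_right[symmetric]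
  proof (rule uniform_lim_mult)
    show "bounded (?e ` closed_segment 0 1)"
      by (intro compact_imp_bounded compact_continuous_image continuous_intros) auto
    show "uniform_limit (closed_segment 0 1) (\<lambda>_. ?e) ?e (finite_subsets_at_top (UNIV :: int set))"
      by (rule uniform_limit_const)
  qed (auto simp: zero bounded_iff intro!: theta_uniform_limit[OF assms, unfolded zero] bounded_closed_segment)
  then have "((\<lambda>X. contour_integral (linepath 0 1) (?S X)) \<longlongrightarrow> contour_integral (linepath 0 1) (\<lambda>z. theta \<tau> z * ?e z))
      (finite_subsets_at_top UNIV)"
    by (intro contour_integral_uniform_limit(2)[where B = 1] eventually_finite_subsets_at_top_weakI
        contour_integrable_sum int) auto
  then have "((\<lambda>X. contour_integral (linepath 0 1) (?S X)) \<longlongrightarrow> 0) (finite_subsets_at_top UNIV)"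
    by (simp add: zero)
  \<comment> \<open>Every finite index set that contains 0 already gives the value
    \<open>a 0\<close>.\<close>
  moreover have "\<forall>\<^sub>F X in finite_subsets_at_top UNIV. contour_integral (linepath 0 1) (?S X) = a 0"
  proof -
    have "\<forall>\<^sub>F X in finite_subsets_at_top (UNIV :: int set). finite X \<and> {0} \<subseteq> X \<and> X \<subseteq> UNIV"
      unfolding eventually_finite_subsets_at_top by blast
    then show ?thesis
      by eventually_elim (use int term_int in \<open>simp add: contour_integral_sum\<close>)
  qed
  ultimately have "((\<lambda>X. a 0) \<longlongrightarrow> 0) (finite_subsets_at_top (UNIV :: int set))"
    by (rule Lim_transform_eventually)
  then have "a 0 = 0"
    by (simp add: tendsto_const_iff)
  then show False by (simp add: a_def)
qed

lemma holomorphic_theta_compose: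
  assumes "Im \<tau> > 0" "f holomorphic_on A"
  shows "(\<lambda>z. theta \<tau> (f z)) holomorphic_on A"
  by (rule entire_compose[OF holomorphic_theta[OF assms(1)] assms(2)])

text \<open>Zeros of an entire function that is not identically zero are isolated. This allows theta
  factors to be treated as nonzero near a point before their zeros are known.\<close>

lemma eventually_theta_affine_nonzero:
  assumes "Im \<tau> > 0" "a \<noteq> 0"
  shows "\<forall>\<^sub>F u in at x. theta \<tau> (a * u + s) \<noteq> 0"
proof -
  obtain z where z: "theta \<tau> z \<noteq> 0"
    using theta_not_identically_zero[OF assms(1)] by blast
  have "\<forall>\<^sub>F u in at x. theta \<tau> (a * u + s) \<noteq> 0 \<and> u \<in> UNIV"
  proof (rule non_zero_neighbour_alt)
    show "(\<lambda>u. theta \<tau> (a * u + s)) holomorphic_on UNIV"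
      by (intro holomorphic_theta_compose holomorphic_intros assms)
    show "theta \<tau> (a * ((z - s) / a) + s) \<noteq> 0"
      using z assms by simp
  qed auto
  then show ?thesis by simp
qed

section \<open>Duplication formula and the values at the half-periods\<close>

lemma exp_minus_pi_i: "exp (x - of_real pi * \<i>) = - exp x"
  by (simp add: exp_diff)

text \<open>Translating u by 1 or by \<tau> permutes the four theta factors in pairs, up to
  multipliers. The exponential prefactor adjusts the total multiplier to that of theta, so
  \<open>quasiperiodic_unique\<close> applies.\<close>

lemma theta_duplication:
  assumes "Im \<tau> > 0"
  obtains k where "k \<noteq> 0" "\<And>u. exp (of_real pi * \<i> * u) * theta \<tau> (u / 2) * theta \<tau> (u / 2 + 1 / 2)
    * theta \<tau> (u / 2 + \<tau> / 2) * theta \<tau> (u / 2 + 1 / 2 + \<tau> / 2) = k * theta \<tau> u"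
proof -
  define G where "G u = exp (of_real pi * \<i> * u) * theta \<tau> (u / 2) * theta \<tau> (u / 2 + 1 / 2)
    * theta \<tau> (u / 2 + \<tau> / 2) * theta \<tau> (u / 2 + 1 / 2 + \<tau> / 2)" for u
  obtain z where z: "theta \<tau> z \<noteq> 0"
    using theta_not_identically_zero[OF assms] by blast
  have "\<exists>k. \<forall>u. G u = k * theta \<tau> u"
  proof (rule quasiperiodic_unique[where F = G and G = "theta \<tau>" and w = z and \<tau> = \<tau>
        and a = "- 1" and b = "- exp (- of_real pi * \<i> * \<tau>)"])
    show "G holomorphic_on UNIV"
      unfolding G_def by (intro holomorphic_intros holomorphic_theta_compose assms) auto
    show "G (u + 1) = - 1 * G u" for u
    proof -
      \<comment> \<open>Both pairs are swapped with one sign each, and these cancel; the remaining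
        -1 comes from the prefactor.\<close>
      have "u / 2 + 1 / 2 + 1 / 2 = u / 2 + 1" "(u + 1) / 2 = u / 2 + 1 / 2"
        "u / 2 + 1 / 2 + 1 / 2 + \<tau> / 2 = (u / 2 + \<tau> / 2) + 1"
        by (simp_all add: field_simps)
      then show ?thesis
        by (simp only: G_def theta_add_one) (simp add: ring_distribs exp_add)
    qed
    show "G (u + \<tau>) = - exp (- of_real pi * \<i> * \<tau>) * exp (- 2 * of_real pi * \<i> * u) * G u" for u
    proof -
      have 1: "(u + \<tau>) / 2 = u / 2 + \<tau> / 2" "u / 2 + \<tau> / 2 + 1 / 2 = u / 2 + 1 / 2 + \<tau> / 2"
        "u / 2 + \<tau> / 2 + \<tau> / 2 = u / 2 + \<tau>" "u / 2 + 1 / 2 + \<tau> / 2 + \<tau> / 2 = (u / 2 + 1 / 2) + \<tau>"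
        by (simp_all add: field_simps)
      \<comment> \<open>The two multipliers arise from the factors that pass a full period, at u/2
        and at u/2 + 1/2.\<close>
      have 2: "exp (of_real pi * \<i> * (u + \<tau>)) * (- exp (- of_real pi * \<i> * \<tau>) * exp (- 2 * of_real pi * \<i> * (u / 2)))
          * (- exp (- of_real pi * \<i> * \<tau>) * exp (- 2 * of_real pi * \<i> * (u / 2 + 1 / 2))) =
          - exp (- of_real pi * \<i> * \<tau>) * exp (- 2 * of_real pi * \<i> * u) * exp (of_real pi * \<i> * u)"
      proof -
        have "exp (- 2 * of_real pi * \<i> * (u / 2 + 1 / 2)) = - exp (- of_real pi * \<i> * u)"
          by (subst exp_minus_pi_i[symmetric], rule arg_cong[of _ _ exp]) (simp add: field_simps)
        moreover have "exp (- 2 * of_real pi * \<i> * u) = exp (- of_real pi * \<i> * u) * exp (- of_real pi * \<i> * u)"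
          by (simp add: mult_ac flip: exp_add)
        ultimately show ?thesis
          by (simp add: ring_distribs exp_add exp_minus field_simps)
      qed
      have "G (u + \<tau>) = (exp (of_real pi * \<i> * (u + \<tau>)) * (- exp (- of_real pi * \<i> * \<tau>) * exp (- 2 * of_real pi * \<i> * (u / 2)))
          * (- exp (- of_real pi * \<i> * \<tau>) * exp (- 2 * of_real pi * \<i> * (u / 2 + 1 / 2))))
          * (theta \<tau> (u / 2) * theta \<tau> (u / 2 + 1 / 2)
            * theta \<tau> (u / 2 + \<tau> / 2) * theta \<tau> (u / 2 + 1 / 2 + \<tau> / 2))"
        by (simp only: G_def 1 theta_add_tau mult_ac)
      then show ?thesis
        unfolding 2 by (simp only: G_def mult_ac)
    qed
    show "theta \<tau> (u + 1) = - 1 * theta \<tau> u" for u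
      by (simp add: theta_add_one)
  qed (use z holomorphic_theta[OF assms] in \<open>simp_all add: theta_add_tau\<close>)
  then obtain k where k: "\<And>u. G u = k * theta \<tau> u" by blast
  have "k \<noteq> 0"
  proof
    assume "k = 0"
    \<comment> \<open>For k = 0 the product would vanish identically, although each of its factors
      is nonzero near 0, away from 0 itself.\<close>
    have half: "\<forall>\<^sub>F u in at 0. theta \<tau> (u / 2 + s) \<noteq> 0" for s
      using eventually_theta_affine_nonzero[OF assms, of "1 / 2" s 0] by simp
    have "\<forall>\<^sub>F u in at (0 :: complex). False"
      using half[of 0] half[of "1 / 2"] half[of "\<tau> / 2"] half[of "1 / 2 + \<tau> / 2"]
    proof eventually_elim
      case (elim u)
      then show False using k[of u] \<open>k = 0\<close> by (simp add: G_def add.assoc)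
    qed
    then show False by simp
  qed
  then show thesis
    using k unfolding G_def by (rule that)
qed

text \<open>The order of vanishing at \<open>0\<close> agrees on the two sides of the duplication formula, and on the
  left it is the sum of the orders at all four half-periods.\<close>

lemma theta_half_periods_nonzero:
  assumes "Im \<tau> > 0"
  shows "theta \<tau> (1 / 2) \<noteq> 0" "theta \<tau> (\<tau> / 2) \<noteq> 0" "theta \<tau> ((1 + \<tau>) / 2) \<noteq> 0"
proof -
  \<comment> \<open>This is the product without theta(u/2). Its value at 0 is the product of the
    three theta values in question, so it suffices that \<open>R 0\<close> is nonzero.\<close>
  define R where "R u = exp (of_real pi * \<i> * u) * theta \<tau> (u / 2 + 1 / 2)
    * theta \<tau> (u / 2 + \<tau> / 2) * theta \<tau> (u / 2 + 1 / 2 + \<tau> / 2)" for u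
  obtain k where "k \<noteq> 0" and dup: "\<And>u. exp (of_real pi * \<i> * u) * theta \<tau> (u / 2) * theta \<tau> (u / 2 + 1 / 2)
    * theta \<tau> (u / 2 + \<tau> / 2) * theta \<tau> (u / 2 + 1 / 2 + \<tau> / 2) = k * theta \<tau> u"
    by (rule theta_duplication[OF assms]) blast
  have k: "R u * theta \<tau> (u / 2) = k * theta \<tau> u" for u
    using dup[of u] unfolding R_def by (simp only: mult_ac)
  have "\<not> theta \<tau> constant_on UNIV"
    using theta_not_identically_zero[OF assms] theta_0 by (metis UNIV_I constant_on_def)
  then obtain g r n where "0 < r" and g: "g holomorphic_on ball 0 r"
    and factor: "\<And>w. w \<in> ball 0 r \<Longrightarrow> theta \<tau> w = (w - 0) ^ n * g w"
    and gnz: "\<And>w. w \<in> ball 0 r \<Longrightarrow> g w \<noteq> 0"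
    using holomorphic_factor_zero_nonconstant[OF holomorphic_theta[OF assms] open_UNIV connected_UNIV, of 0] theta_0
    by (metis UNIV_I)
  have "\<forall>\<^sub>F u in at 0. u \<in> ball 0 r - {0 :: complex}"
    using \<open>0 < r\<close> by (intro eventually_at_in_open) auto
  \<comment> \<open>The common power u^n is cancelled, where n is the order of the zero at 0; the
    constant 2^n stems from (u/2)^n.\<close>
  then have ev: "\<forall>\<^sub>F u in at 0. R u * g (u / 2) = 2 ^ n * k * g u"
  proof eventually_elim
    case (elim u)
    then have "u / 2 \<in> ball 0 r" using \<open>0 < r\<close> by (simp add: norm_divide)
    then show ?case
      using elim k[of u] factor[of u] factor[of "u / 2"] by (simp add: power_divide field_simps)
  qed
  have g0: "isCont g 0"
    using continuous_on_interior[OF holomorphic_on_imp_continuous_on[OF g]] \<open>0 < r\<close> by simp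
  have "R holomorphic_on UNIV"
    unfolding R_def by (intro holomorphic_intros holomorphic_theta_compose assms) auto
  then have R0: "isCont R 0"
    using continuous_on_interior[OF holomorphic_on_imp_continuous_on] by force
  have "isCont (\<lambda>u :: complex. u / 2) 0"
    by (intro continuous_intros) auto
  then have "isCont (\<lambda>u. g (u / 2)) 0"
    using isCont_o2[of 0 "\<lambda>u. u / 2" g] g0 by simp
  with R0 have "isCont (\<lambda>u. R u * g (u / 2)) 0"
    by (rule isCont_mult)
  moreover have "isCont (\<lambda>u. 2 ^ n * k * g u) 0"
    by (rule isCont_mult[OF continuous_const g0])
  ultimately have "((\<lambda>u. R u * g (u / 2)) \<longlongrightarrow> R 0 * g (0 / 2)) (at 0)" "((\<lambda>u. 2 ^ n * k * g u) \<longlongrightarrow> 2 ^ n * k * g 0) (at 0)"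
    unfolding isCont_def .
  from tendsto_unique[OF at_neq_bot Lim_transform_eventually[OF this(1) ev] this(2)]
  have "R 0 * g (0 / 2) = 2 ^ n * k * g 0" .
  then have "R 0 \<noteq> 0"
    using \<open>k \<noteq> 0\<close> \<open>0 < r\<close> gnz[of 0] by auto
  then show "theta \<tau> (1 / 2) \<noteq> 0" "theta \<tau> (\<tau> / 2) \<noteq> 0" "theta \<tau> ((1 + \<tau>) / 2) \<noteq> 0"
    by (auto simp: R_def add_divide_distrib)
qed

section \<open>Wronskian of theta and its half-shift; the zero at 0 is simple\<close>

lemma theta_has_derivative:
  assumes "Im \<tau> > 0"
  shows "(theta \<tau> has_field_derivative deriv (theta \<tau>) z) (at z)"
  using holomorphic_derivI[OF holomorphic_theta[OF assms]] by auto

lemma deriv_theta_add_one: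
  assumes "Im \<tau> > 0"
  shows "deriv (theta \<tau>) (z + 1) = - deriv (theta \<tau>) z"
proof -
  have "((\<lambda>z. theta \<tau> (z + 1)) has_field_derivative deriv (theta \<tau>) (z + 1)) (at z)"
    using theta_has_derivative[OF assms] DERIV_shift by blast
  moreover have "((\<lambda>z. - theta \<tau> z) has_field_derivative - deriv (theta \<tau>) z) (at z)"
    by (intro derivative_intros theta_has_derivative assms)
  ultimately show ?thesis
    by (simp add: theta_add_one DERIV_unique)
qed

lemma deriv_theta_add_tau:
  assumes "Im \<tau> > 0"
  shows "deriv (theta \<tau>) (z + \<tau>) =
    - exp (- of_real pi * \<i> * \<tau>) * exp (- 2 * of_real pi * \<i> * z) * (deriv (theta \<tau>) z - 2 * of_real pi * \<i> * theta \<tau> z)"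
proof -
  let ?c = "- exp (- of_real pi * \<i> * \<tau>)"
  have "((\<lambda>z. theta \<tau> (z + \<tau>)) has_field_derivative deriv (theta \<tau>) (z + \<tau>)) (at z)"
    using theta_has_derivative[OF assms] DERIV_shift by blast
  moreover have "((\<lambda>z. ?c * exp (- 2 * of_real pi * \<i> * z) * theta \<tau> z) has_field_derivative
      ?c * exp (- 2 * of_real pi * \<i> * z) * (deriv (theta \<tau>) z - 2 * of_real pi * \<i> * theta \<tau> z)) (at z)"
    by (rule derivative_eq_intros theta_has_derivative[OF assms] refl)+ (simp add: algebra_simps)
  ultimately show ?thesis
    unfolding theta_add_tau by (rule DERIV_unique)
qed

text \<open>Both sides have period 1/2 and the same multiplier under z + \<tau>: in the Wronskian
  the terms from differentiating the exponential cancel. Replacing z by z/2 turns the periods into 1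
  and 2 \<tau>, to which \<open>quasiperiodic_unique\<close> applies.\<close>

lemma theta_wronskian:
  assumes "Im \<tau> > 0"
  obtains k where "\<And>z. deriv (theta \<tau>) z * theta \<tau> (z + 1 / 2) - theta \<tau> z * deriv (theta \<tau>) (z + 1 / 2) =
    k * (exp (2 * of_real pi * \<i> * z) * theta \<tau> (z + \<tau> / 2) * theta \<tau> (z + 1 / 2 + \<tau> / 2))"
proof -
  define W where "W z = deriv (theta \<tau>) z * theta \<tau> (z + 1 / 2) - theta \<tau> z * deriv (theta \<tau>) (z + 1 / 2)" for z
  define P where "P z = exp (2 * of_real pi * \<i> * z) * theta \<tau> (z + \<tau> / 2) * theta \<tau> (z + 1 / 2 + \<tau> / 2)" for z
  have holD: "deriv (theta \<tau>) holomorphic_on UNIV"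
    using holomorphic_deriv[OF holomorphic_theta[OF assms]] by simp
  have W_half: "W (z + 1 / 2) = W z" for z
  proof -
    have "z + 1 / 2 + 1 / 2 = z + 1" by simp
    then show ?thesis
      by (simp only: W_def theta_add_one deriv_theta_add_one[OF assms]) simp
  qed
  have P_half: "P (z + 1 / 2) = P z" for z
  proof -
    have "z + 1 / 2 + 1 / 2 + \<tau> / 2 = (z + \<tau> / 2) + 1" by simp
    then show ?thesis
      by (simp only: P_def theta_add_one) (simp add: ring_distribs exp_add)
  qed
  \<comment> \<open>Two theta multipliers are combined here; their arguments differ by 1/2, which
    accounts for the sign.\<close>
  let ?m = "\<lambda>z. - (exp (- of_real pi * \<i> * \<tau>) * exp (- 2 * of_real pi * \<i> * z))\<^sup>2"
  have W_tau: "W (z + \<tau>) = ?m z * W z" for z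
  proof -
    have 1: "z + \<tau> + 1 / 2 = (z + 1 / 2) + \<tau>" by simp
    have 2: "exp (- 2 * of_real pi * \<i> * (z + 1 / 2)) = - exp (- 2 * of_real pi * \<i> * z)"
      by (simp add: ring_distribs exp_diff exp_minus)
    show ?thesis
      unfolding W_def 1 theta_add_tau deriv_theta_add_tau[OF assms] 2
      by (simp add: power2_eq_square algebra_simps)
  qed
  have P_tau: "P (z + \<tau>) = ?m z * P z" for z
  proof -
    have 1: "z + \<tau> + \<tau> / 2 = (z + \<tau> / 2) + \<tau>" "z + \<tau> + 1 / 2 + \<tau> / 2 = (z + 1 / 2 + \<tau> / 2) + \<tau>"
      by simp_all
    have 2: "exp (2 * of_real pi * \<i> * (z + \<tau>)) = exp (2 * of_real pi * \<i> * z) * exp (of_real pi * \<i> * \<tau>) ^ 2"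
      "exp (- 2 * of_real pi * \<i> * (z + \<tau> / 2)) = exp (- 2 * of_real pi * \<i> * z) * exp (- of_real pi * \<i> * \<tau>)"
      "exp (- 2 * of_real pi * \<i> * (z + 1 / 2 + \<tau> / 2)) = - exp (- 2 * of_real pi * \<i> * z) * exp (- of_real pi * \<i> * \<tau>)"
      subgoal by (subst exp_double[symmetric], subst exp_add[symmetric], rule arg_cong[of _ _ exp]) (simp add: field_simps)
      subgoal by (subst exp_add[symmetric], rule arg_cong[of _ _ exp]) (simp add: field_simps)
      subgoal by (unfold mult_minus_left, subst exp_add[symmetric], subst exp_minus_pi_i[symmetric], rule arg_cong[of _ _ exp])
        (simp add: field_simps)
      done
    show ?thesis
      unfolding P_def 1 theta_add_tau 2
      by (simp add: power2_eq_square exp_minus field_simps)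
  qed
  \<comment> \<open>At z/2 the squared exponential has exactly the form of a theta multiplier for 2
    \<tau>.\<close>
  have m_half: "?m (z / 2) = - exp (- of_real pi * \<i> * (2 * \<tau>)) * exp (- 2 * of_real pi * \<i> * z)" for z
    by (simp add: power_mult_distrib exp_minus field_simps exp_double[symmetric])
  obtain w where w: "P (w / 2) \<noteq> 0"
  proof -
    have aff: "\<forall>\<^sub>F u in at 0. theta \<tau> (u + s) \<noteq> 0" for s
      using eventually_theta_affine_nonzero[OF assms one_neq_zero, of s 0] by simp
    have "\<forall>\<^sub>F u in at (0::complex). P u \<noteq> 0"
      using aff[of "\<tau> / 2"] aff[of "1 / 2 + \<tau> / 2"] by eventually_elim (simp add: P_def add.assoc)
    then obtain u where "P u \<noteq> 0"
      using eventually_happens by fastforce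
    then show thesis using that[of "2 * u"] by simp
  qed
  have "\<exists>k. \<forall>z. W (z / 2) = k * P (z / 2)"
  proof (rule quasiperiodic_unique[where F = "\<lambda>z. W (z / 2)" and G = "\<lambda>z. P (z / 2)" and w = w
        and \<tau> = "2 * \<tau>" and a = 1 and b = "- exp (- of_real pi * \<i> * (2 * \<tau>))"])
    show "(\<lambda>z. W (z / 2)) holomorphic_on UNIV" "(\<lambda>z. P (z / 2)) holomorphic_on UNIV"
      unfolding W_def P_def
      by (intro holomorphic_intros holomorphic_theta_compose assms entire_compose[OF holD]; simp)+
    show "W ((z + 1) / 2) = 1 * W (z / 2)" "P ((z + 1) / 2) = 1 * P (z / 2)" for z
      using W_half[of "z / 2"] P_half[of "z / 2"] by (simp_all add: add_divide_distrib)
    have "(z + 2 * \<tau>) / 2 = z / 2 + \<tau>" for z by simp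
    then show "W ((z + 2 * \<tau>) / 2) = - exp (- of_real pi * \<i> * (2 * \<tau>)) * exp (- 2 * of_real pi * \<i> * z) * W (z / 2)"
      "P ((z + 2 * \<tau>) / 2) = - exp (- of_real pi * \<i> * (2 * \<tau>)) * exp (- 2 * of_real pi * \<i> * z) * P (z / 2)" for z
      by (simp_all only: W_tau P_tau m_half)
  qed (use w in auto)
  then obtain k where k: "\<And>z. W (z / 2) = k * P (z / 2)" by blast
  show thesis
  proof (rule that)
    show "deriv (theta \<tau>) z * theta \<tau> (z + 1 / 2) - theta \<tau> z * deriv (theta \<tau>) (z + 1 / 2) =
      k * (exp (2 * of_real pi * \<i> * z) * theta \<tau> (z + \<tau> / 2) * theta \<tau> (z + 1 / 2 + \<tau> / 2))" for z
      using k[of "2 * z"] by (simp add: W_def P_def)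
  qed
qed

text \<open>A double zero at 0 would make the Wronskian vanish identically. The quotient theta(z) /
  theta(z + 1/2) would then be constant near 0, with value 0, and theta would vanish on a
  disc.\<close>

lemma deriv_theta_0_nonzero:
  assumes "Im \<tau> > 0"
  shows "deriv (theta \<tau>) 0 \<noteq> 0"
proof
  assume zero: "deriv (theta \<tau>) 0 = 0"
  let ?D = "deriv (theta \<tau>)"
  obtain k where k: "\<And>z. ?D z * theta \<tau> (z + 1 / 2) - theta \<tau> z * ?D (z + 1 / 2) =
    k * (exp (2 * of_real pi * \<i> * z) * theta \<tau> (z + \<tau> / 2) * theta \<tau> (z + 1 / 2 + \<tau> / 2))"
    using theta_wronskian[OF assms] by metis
  \<comment> \<open>At z = 0 the Wronskian vanishes, but the function multiplied by \<open>k\<close>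
    is a product of theta values at half-periods.\<close>
  have "k = 0"
    using k[of 0] zero theta_half_periods_nonzero[OF assms] by (simp add: theta_0 add_divide_distrib)
  have cont: "isCont (\<lambda>z. theta \<tau> (z + 1 / 2)) 0"
    using theta_has_derivative[OF assms, of "0 + 1 / 2"] by (intro DERIV_isCont) (rule DERIV_shift[THEN iffD1])
  obtain r where "r > 0" and r: "\<And>z. dist 0 z < r \<Longrightarrow> theta \<tau> (z + 1 / 2) \<noteq> 0"
    using continuous_at_avoid[OF cont, of 0] theta_half_periods_nonzero(1)[OF assms] by auto
  let ?q = "\<lambda>z. theta \<tau> z / theta \<tau> (z + 1 / 2)"
  have "(?q has_field_derivative 0) (at z)" if "z \<in> ball 0 r" for z
  proof -
    have "((\<lambda>z. theta \<tau> (z + 1 / 2)) has_field_derivative ?D (z + 1 / 2)) (at z)"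
      by (rule DERIV_shift[THEN iffD1, OF theta_has_derivative[OF assms]])
    from DERIV_divide[OF theta_has_derivative[OF assms] this] r[of z] that
    show ?thesis
      using k[of z] \<open>k = 0\<close> by simp
  qed
  then have "?q constant_on ball 0 r"
    by (intro has_field_derivative_0_imp_constant_on) (auto simp del: mem_ball)
  then obtain c where c: "\<And>z. z \<in> ball 0 r \<Longrightarrow> ?q z = c"
    unfolding constant_on_def by blast
  have "theta \<tau> z = 0" if "z \<in> ball 0 r" for z
    using c[OF that] c[of 0] r[of z] that \<open>r > 0\<close> by (auto simp: theta_0)
  note zero_near = this
  have "\<forall>\<^sub>F z in at 0. z \<in> ball 0 r"
    using \<open>r > 0\<close> by (intro eventually_at_in_open') auto
  then have "\<forall>\<^sub>F z in at (0 :: complex). False"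
    using eventually_theta_affine_nonzero[OF assms one_neq_zero, of 0 0]
    by eventually_elim (simp add: zero_near)
  then show False by simp
qed

section \<open>The functions \<open>\<phi>\<^sub>\<alpha>\<close> and the Lax matrix\<close>

lemma deriv_half_period:
  "deriv (half_period \<alpha>) \<tau> = (if \<alpha> = 2 \<or> \<alpha> = 3 then 1 / 2 else 0)"
proof -
  have "(half_period \<alpha> has_field_derivative (if \<alpha> = 2 \<or> \<alpha> = 3 then 1 / 2 else 0)) (at \<tau>)"
    by (cases "\<alpha> = 1"; cases "\<alpha> = 2"; cases "\<alpha> = 3")
       (auto simp: half_period_def[abs_def] intro!: derivative_eq_intros)
  then show ?thesis by (rule DERIV_imp_deriv)
qed

lemma half_period_cases:
  fixes \<alpha> :: nat
  assumes "\<alpha> \<in> {1..3}"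
  obtains "\<alpha> = 1" | "\<alpha> = 2" | "\<alpha> = 3"
proof -
  have "\<alpha> = 1 \<or> \<alpha> = 2 \<or> \<alpha> = 3"
    using assms by auto
  then show thesis
    using that by blast
qed

text \<open>For \<alpha> in 1..3 and a in 0..3 this is the Weil pairing of the 2-torsion points
  given by the two half-periods.\<close>

definition varphi_sign :: "nat \<Rightarrow> nat \<Rightarrow> complex" where
  "varphi_sign \<alpha> a = (if a = 0 \<or> a = \<alpha> then 1 else - 1)"

text \<open>The two arguments differ by a full period. Centring them at z cancels the part of the
  multiplier that is independent of z.\<close>

lemma theta_add_half_period:
  assumes "\<alpha> \<in> {1..3}"
  shows "theta \<tau> (z + half_period \<alpha> \<tau>) =
    - exp (- 4 * of_real pi * \<i> * z * deriv (half_period \<alpha>) \<tau>) * theta \<tau> (z - half_period \<alpha> \<tau>)"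
  using assms
proof (cases \<alpha> rule: half_period_cases)
  case 1
  have "z - 1 / 2 + 1 = z + 1 / 2" by simp
  then show ?thesis
    using theta_add_one[of \<tau> "z - 1 / 2"] 1 by (simp only: half_period_def deriv_half_period) simp
next
  case 2
  have shift: "z - \<tau> / 2 + \<tau> = z + \<tau> / 2" by simp
  have "- exp (- of_real pi * \<i> * \<tau>) * exp (- 2 * of_real pi * \<i> * (z - \<tau> / 2)) =
      - exp (- 4 * of_real pi * \<i> * z * (1 / 2))"
    unfolding mult_minus_left exp_add[symmetric] neg_equal_iff_equal
    by (rule arg_cong[of _ _ exp]) (simp add: field_simps)
  then show ?thesis
    using theta_add_tau[of \<tau> "z - \<tau> / 2"] 2 unfolding shift
    by (simp only: half_period_def deriv_half_period) simp
next
  case 3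
  have shift: "z - (1 + \<tau>) / 2 + \<tau> + 1 = z + (1 + \<tau>) / 2" by (simp add: field_simps)
  have "exp (- of_real pi * \<i> * \<tau>) * exp (- 2 * of_real pi * \<i> * (z - (1 + \<tau>) / 2)) =
      exp (- 4 * of_real pi * \<i> * z * (1 / 2) + of_real pi * \<i>)"
    unfolding exp_add[symmetric] by (rule arg_cong[of _ _ exp]) (simp add: field_simps)
  also have "\<dots> = - exp (- 4 * of_real pi * \<i> * z * (1 / 2))"
    by (subst exp_add) simp
  finally have "theta \<tau> (z - (1 + \<tau>) / 2 + \<tau>) =
      exp (- 4 * of_real pi * \<i> * z * (1 / 2)) * theta \<tau> (z - (1 + \<tau>) / 2)"
    unfolding theta_add_tau mult_minus_left by simp
  then show ?thesis
    using theta_add_one[of \<tau> "z - (1 + \<tau>) / 2 + \<tau>"] 3 unfolding shift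
    by (simp only: half_period_def deriv_half_period) simp
qed

text \<open>Oddness of theta replaces theta(z + w) by theta(z - w), with w the half-period, and the
  exponential prefactor of \<open>varphi\<close> absorbs the multiplier between the two.\<close>

lemma varphi_uminus:
  assumes "\<alpha> \<in> {1..3}"
  shows "varphi \<alpha> \<tau> (- z) = - varphi \<alpha> \<tau> z"
proof -
  let ?d = "deriv (half_period \<alpha>) \<tau>" and ?w = "half_period \<alpha> \<tau>"
  have "theta \<tau> (- z + ?w) = - theta \<tau> (z - ?w)"
    using theta_minus[of \<tau> "z - ?w"] by simp
  moreover have "exp (2 * of_real pi * \<i> * z * ?d) * exp (- 4 * of_real pi * \<i> * z * ?d) = exp (2 * of_real pi * \<i> * (- z) * ?d)"
    unfolding exp_add[symmetric] by (rule arg_cong[of _ _ exp]) (simp add: algebra_simps)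
  ultimately show ?thesis
    unfolding varphi_def kronecker_phi_def theta_minus theta_add_half_period[OF assms] by simp
qed

lemma varphi_add_one:
  assumes "\<alpha> \<in> {1..3}"
  shows "varphi \<alpha> \<tau> (z + 1) = varphi_sign \<alpha> 1 * varphi \<alpha> \<tau> z"
proof -
  have "theta \<tau> (z + 1 + w) = - theta \<tau> (z + w)" for w
    using theta_add_one[of \<tau> "z + w"] by (simp add: add_ac)
  then have kronecker: "kronecker_phi \<tau> (z + 1) w = kronecker_phi \<tau> z w" for w
    by (simp add: kronecker_phi_def theta_add_one)
  have "exp (2 * of_real pi * \<i> * (z + 1) * deriv (half_period \<alpha>) \<tau>) =
      exp (2 * of_real pi * \<i> * deriv (half_period \<alpha>) \<tau>) * exp (2 * of_real pi * \<i> * z * deriv (half_period \<alpha>) \<tau>)"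
    unfolding exp_add[symmetric] by (rule arg_cong[of _ _ exp]) (simp add: algebra_simps)
  also have "exp (2 * of_real pi * \<i> * deriv (half_period \<alpha>) \<tau>) = varphi_sign \<alpha> 1"
    using assms by (cases \<alpha> rule: half_period_cases) (simp_all add: deriv_half_period varphi_sign_def)
  finally have "exp (2 * of_real pi * \<i> * (z + 1) * deriv (half_period \<alpha>) \<tau>) =
      varphi_sign \<alpha> 1 * exp (2 * of_real pi * \<i> * z * deriv (half_period \<alpha>) \<tau>)" .
  then show ?thesis
    by (simp add: varphi_def kronecker)
qed

lemma varphi_add_tau:
  assumes "\<alpha> \<in> {1..3}"
  shows "varphi \<alpha> \<tau> (z + \<tau>) = varphi_sign \<alpha> 2 * varphi \<alpha> \<tau> z"
proof -
  let ?d = "deriv (half_period \<alpha>) \<tau>" and ?w = "half_period \<alpha> \<tau>"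
  let ?m = "\<lambda>z. - exp (- of_real pi * \<i> * \<tau>) * exp (- 2 * of_real pi * \<i> * z)"
  have m: "?m (z + ?w) = exp (- 2 * of_real pi * \<i> * ?w) * ?m z"
    by (simp add: ring_distribs exp_add exp_diff exp_minus field_simps)
  have "z + \<tau> + ?w = z + ?w + \<tau>" by simp
  then have "varphi \<alpha> \<tau> (z + \<tau>) = exp (2 * of_real pi * \<i> * (z + \<tau>) * ?d) * (?m (z + ?w) / ?m z) *
      kronecker_phi \<tau> z ?w"
    unfolding varphi_def kronecker_phi_def by (simp only: theta_add_tau) simp
  also have "?m (z + ?w) / ?m z = exp (- 2 * of_real pi * \<i> * ?w)"
    unfolding m by simp
  also have "exp (2 * of_real pi * \<i> * (z + \<tau>) * ?d) * exp (- 2 * of_real pi * \<i> * ?w) =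
      exp (2 * of_real pi * \<i> * (\<tau> * ?d - ?w)) * exp (2 * of_real pi * \<i> * z * ?d)"
    unfolding exp_add[symmetric] by (rule arg_cong[of _ _ exp]) (simp add: algebra_simps)
  \<comment> \<open>The difference \<open>\<tau> * ?d - ?w\<close> is 0 for \<alpha> = 2 and -1/2
    for \<alpha> = 1 and \<alpha> = 3.\<close>
  also have "exp (2 * of_real pi * \<i> * (\<tau> * ?d - ?w)) = varphi_sign \<alpha> 2"
    using assms by (cases \<alpha> rule: half_period_cases)
      (simp_all add: half_period_def deriv_half_period varphi_sign_def add_divide_distrib algebra_simps exp_minus)
  finally show ?thesis
    by (simp add: varphi_def)
qed

lemma varphi_add_period:
  assumes "\<alpha> \<in> {1..3}" "a \<le> 3"
  shows "varphi \<alpha> \<tau> (z + 2 * half_period a \<tau>) = varphi_sign \<alpha> a * varphi \<alpha> \<tau> z"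
proof -
  have "a = 0 \<or> a \<in> {1..3}" using assms(2) by auto
  then show ?thesis
  proof
    assume "a \<in> {1..3}"
    then show ?thesis
    proof (cases a rule: half_period_cases)
      case 3
      have "z + (1 + \<tau>) = z + 1 + \<tau>" by simp
      then have "varphi \<alpha> \<tau> (z + (1 + \<tau>)) = varphi_sign \<alpha> 2 * (varphi_sign \<alpha> 1 * varphi \<alpha> \<tau> z)"
        by (simp only: varphi_add_one[OF assms(1)] varphi_add_tau[OF assms(1)])
      moreover have "varphi_sign \<alpha> 2 * varphi_sign \<alpha> 1 = varphi_sign \<alpha> 3"
        using assms(1) by (cases \<alpha> rule: half_period_cases) (simp_all add: varphi_sign_def)
      moreover have "2 * half_period a \<tau> = 1 + \<tau>"
        using 3 by (simp add: half_period_def)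
      ultimately show ?thesis
        using 3 by (simp only: mult.assoc[symmetric])
    qed (use varphi_add_one[OF assms(1)] varphi_add_tau[OF assms(1)] in \<open>simp_all add: half_period_def\<close>)
  qed (simp add: half_period_def varphi_sign_def)
qed

text \<open>Oddness passes to the argument z + w, with w the half-period of index a, and this
  exceeds z - w by the period 2 w.\<close>

lemma varphi_reflect:
  assumes "\<alpha> \<in> {1..3}" "a \<le> 3"
  shows "varphi \<alpha> \<tau> (- z - half_period a \<tau>) = - varphi_sign \<alpha> a * varphi \<alpha> \<tau> (z - half_period a \<tau>)"
  using varphi_add_period[OF assms, of \<tau> "z - half_period a \<tau>"] varphi_uminus[OF assms(1), of \<tau> "z + half_period a \<tau>"]
  by (simp add: algebra_simps)

text \<open>This holds at every \<open>z\<close>: division by zero makes both sides \<open>0\<close> at a common pole.\<close>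

lemma varphi_minus_half_period:
  assumes "\<alpha> \<in> {1..3}"
  shows "nu_tilde S \<alpha> * varphi \<alpha> \<tau> (z - half_period \<alpha> \<tau>) = nu_prime \<tau> S \<alpha> * (1 / varphi \<alpha> \<tau> z)"
proof -
  let ?d = "deriv (half_period \<alpha>) \<tau>" and ?w = "half_period \<alpha> \<tau>"
  let ?D = "deriv (theta \<tau>) 0"
  let ?e = "\<lambda>z. exp (2 * of_real pi * \<i> * z * ?d)"
  have "?e (z - ?w) = exp (- 2 * of_real pi * \<i> * ?w * ?d) * ?e z"
    unfolding exp_add[symmetric] by (rule arg_cong[of _ _ exp]) (simp add: algebra_simps)
  then have L: "varphi \<alpha> \<tau> (z - ?w) =
      exp (- 2 * of_real pi * \<i> * ?w * ?d) * ?e z * theta \<tau> z * ?D / (theta \<tau> (z - ?w) * theta \<tau> ?w)"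
    by (simp add: varphi_def kronecker_phi_def)
  have "exp (- 4 * of_real pi * \<i> * z * ?d) = inverse (?e z) * inverse (?e z)"
    unfolding exp_minus[symmetric] exp_add[symmetric] by (rule arg_cong[of _ _ exp]) (simp add: algebra_simps)
  \<comment> \<open>Written through theta(z - w), this has the z-dependent theta factors of
    \<open>L\<close> with numerator and denominator exchanged.\<close>
  then have "varphi \<alpha> \<tau> z = - theta \<tau> (z - ?w) * ?D / (?e z * theta \<tau> z * theta \<tau> ?w)"
    unfolding varphi_def kronecker_phi_def theta_add_half_period[OF assms]
    by (simp add: divide_inverse mult_ac)
  then have R: "1 / varphi \<alpha> \<tau> z = - (?e z * theta \<tau> z * theta \<tau> ?w / (theta \<tau> (z - ?w) * ?D))"
    by simp
  show ?thesis
    unfolding L R nu_prime_def by (simp add: power2_eq_square power_divide mult_ac)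
qed

lemma meromorphic_varphi_compose:
  assumes "Im \<tau> > 0"
  shows "(\<lambda>z. varphi \<alpha> \<tau> (z - s)) meromorphic_on UNIV"
proof -
  have "(\<lambda>z. f z) analytic_on UNIV" if "f holomorphic_on UNIV" for f :: "complex \<Rightarrow> complex"
    using that by (simp add: analytic_on_open)
  then have *: "f meromorphic_on UNIV" if "f holomorphic_on UNIV" for f :: "complex \<Rightarrow> complex"
    using that analytic_on_imp_meromorphic_on by blast
  show ?thesis
    unfolding varphi_def kronecker_phi_def
    by (intro meromorphic_on_mult meromorphic_on_divide meromorphic_on_const *
        holomorphic_theta_compose[OF assms] holomorphic_intros)
qed

section \<open>The Lax matrix and its parts under the involution\<close>

lemma cscale_component: "(c *\<^sub>m A) $ i $ j = c * A $ i $ j"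
  by (simp add: cscale_def)

lemma meromorphic_lax:
  assumes "Im \<tau> > 0"
  shows "meromorphic_matrix (lax \<tau> S)"
  unfolding meromorphic_matrix_def lax_def sum_component cscale_component
  by (intro allI meromorphic_on_sum meromorphic_on_mult meromorphic_on_const meromorphic_varphi_compose[OF assms])

definition lax_coord :: "complex \<Rightarrow> (nat \<Rightarrow> nat \<Rightarrow> complex) \<Rightarrow> nat \<Rightarrow> complex \<Rightarrow> complex" where
  "lax_coord \<tau> S \<alpha> z = (\<Sum>a=0..3. S a \<alpha> * varphi \<alpha> \<tau> (z - half_period a \<tau>))"

lemma lax_eq: "lax \<tau> S z = (\<Sum>\<alpha>=1..3. lax_coord \<tau> S \<alpha> z *\<^sub>m pauli \<alpha>)"
  unfolding lax_def by (subst sum.swap)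
    (simp add: vec_eq_iff cscale_component lax_coord_def sum_distrib_right)

lemma lax_coord_minus:
  assumes "\<alpha> \<in> {1..3}"
  shows "lax_coord \<tau> S \<alpha> (- z) = - (\<Sum>a=0..3. varphi_sign \<alpha> a * S a \<alpha> * varphi \<alpha> \<tau> (z - half_period a \<tau>))"
  unfolding lax_coord_def sum_negf[symmetric]
  by (intro sum.cong refl) (simp add: varphi_reflect[OF assms])

text \<open>Averaging over the involution acts on each summand as a weight, half of 1 plus its sign.
  The reflection rule holds at every z, so no exceptional set arises at the poles.\<close>

lemma plus_part_lax:
  "plus_part (lax \<tau> S) z = (\<Sum>\<alpha>=1..3. (S 0 \<alpha> * varphi \<alpha> \<tau> z
      + nu_tilde S \<alpha> * varphi \<alpha> \<tau> (z - half_period \<alpha> \<tau>)) *\<^sub>m pauli \<alpha>)"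
proof -
  have "(lax_coord \<tau> S \<alpha> z - lax_coord \<tau> S \<alpha> (- z)) / 2 =
      S 0 \<alpha> * varphi \<alpha> \<tau> z + nu_tilde S \<alpha> * varphi \<alpha> \<tau> (z - half_period \<alpha> \<tau>)" if "\<alpha> \<in> {1..3}" for \<alpha>
  proof -
    have "lax_coord \<tau> S \<alpha> z - lax_coord \<tau> S \<alpha> (- z) =
        (\<Sum>a=0..3. (1 + varphi_sign \<alpha> a) * S a \<alpha> * varphi \<alpha> \<tau> (z - half_period a \<tau>))"
      unfolding lax_coord_minus[OF that] by (simp add: lax_coord_def ring_distribs sum.distrib)
    \<comment> \<open>The factor \<open>1 + varphi_sign \<alpha> a\<close> is 2 on these two indices
      and 0 on the others.\<close>
    also have "\<dots> = (\<Sum>a\<in>{0, \<alpha>}. 2 * S a \<alpha> * varphi \<alpha> \<tau> (z - half_period a \<tau>))"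
      using that by (intro sum.mono_neutral_cong_right) (auto simp: varphi_sign_def)
    finally show ?thesis
      using that by (simp add: half_period_def nu_tilde_def)
  qed
  note coord = this
  have "plus_part (lax \<tau> S) z = (\<Sum>\<alpha>=1..3. ((lax_coord \<tau> S \<alpha> z - lax_coord \<tau> S \<alpha> (- z)) / 2) *\<^sub>m pauli \<alpha>)"
    unfolding plus_part_def involution_def lax_eq
    by (simp add: vec_eq_iff cscale_component sum_subtractf[symmetric] sum_divide_distrib algebra_simps diff_divide_distrib)
  also have "\<dots> = (\<Sum>\<alpha>=1..3. (S 0 \<alpha> * varphi \<alpha> \<tau> z
      + nu_tilde S \<alpha> * varphi \<alpha> \<tau> (z - half_period \<alpha> \<tau>)) *\<^sub>m pauli \<alpha>)"
    by (intro sum.cong refl) (simp only: coord)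
  finally show ?thesis .
qed

lemma pauli_independent:
  assumes "(\<Sum>\<alpha>=1..3. c \<alpha> *\<^sub>m pauli \<alpha>) = 0" "\<alpha> \<in> {1..3}"
  shows "c \<alpha> = 0"
proof -
  have "{1..3} = {1, 2, 3 :: nat}" by auto
  with assms(1) have *: "c 1 *\<^sub>m pauli 1 + (c 2 *\<^sub>m pauli 2 + c 3 *\<^sub>m pauli 3) = 0"
    by simp
  have "c 3 = 0"
    using arg_cong[OF *, of "\<lambda>A :: complex^2^2. A $ 1 $ 1"] by (simp add: cscale_component pauli_def)
  moreover have "c 1 - \<i> * c 2 = 0" "c 1 + \<i> * c 2 = 0"
    using arg_cong[OF *, of "\<lambda>A :: complex^2^2. A $ 1 $ 2"] arg_cong[OF *, of "\<lambda>A :: complex^2^2. A $ 2 $ 1"]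
    by (simp_all add: cscale_component pauli_def mult.commute)
  then have "2 * c 1 = 0" "2 * \<i> * c 2 = 0"
    by algebra+
  moreover have "\<alpha> = 1 \<or> \<alpha> = 2 \<or> \<alpha> = 3"
    using assms(2) by auto
  ultimately show ?thesis
    by auto
qed

lemma minus_part_lax:
  "minus_part (lax \<tau> S) z = (\<Sum>\<alpha>=1..3. ((lax_coord \<tau> S \<alpha> z + lax_coord \<tau> S \<alpha> (- z)) / 2) *\<^sub>m pauli \<alpha>)"
  unfolding minus_part_def involution_def lax_eq
  by (simp add: vec_eq_iff cscale_component sum.distrib[symmetric] sum_divide_distrib algebra_simps add_divide_distrib)

section \<open>Residues on the locus where the anti-invariant part vanishes\<close>

lemma theta_half_period_diff_nonzero:
  assumes "Im \<tau> > 0" "a \<in> {1..3}" "b \<in> {1..3}" "a \<noteq> b"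
  shows "theta \<tau> (half_period a \<tau> - half_period b \<tau>) \<noteq> 0"
proof -
  note nz = theta_half_periods_nonzero[OF assms(1)]
  \<comment> \<open>Up to sign and a period, the difference of two distinct nonzero half-periods is
    the third one.\<close>
  have 1: "theta \<tau> (1 / 2 - \<tau> / 2) \<noteq> 0"
    using nz(3) theta_add_one[of \<tau> "- (1 + \<tau>) / 2"] theta_minus[of \<tau> "(1 + \<tau>) / 2"]
    by (simp add: add_divide_distrib diff_divide_distrib)
  have 2: "theta \<tau> (1 / 2 - (1 + \<tau>) / 2) \<noteq> 0" "theta \<tau> (\<tau> / 2 - (1 + \<tau>) / 2) \<noteq> 0"
    using nz(1,2) theta_minus[of \<tau> "\<tau> / 2"] theta_minus[of \<tau> "1 / 2"] by (simp_all add: add_divide_distrib)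
  have swap: "theta \<tau> (x - y) \<noteq> 0 \<Longrightarrow> theta \<tau> (y - x) \<noteq> 0" for x y
    using theta_minus[of \<tau> "x - y"] by simp
  have "a = 1 \<or> a = 2 \<or> a = 3" "b = 1 \<or> b = 2 \<or> b = 3"
    using assms(2,3) by auto
  then show ?thesis
    using assms(4) 1 2 swap[OF 1] swap[OF 2(1)] swap[OF 2(2)]
    by (elim disjE) (simp_all add: half_period_def)
qed

lemma theta_half_period_nonzero:
  assumes "Im \<tau> > 0" "\<alpha> \<in> {1..3}"
  shows "theta \<tau> (half_period \<alpha> \<tau>) \<noteq> 0"
  using assms(2)
  by (cases \<alpha> rule: half_period_cases)
     (simp_all add: half_period_def theta_half_periods_nonzero[OF assms(1)])

text \<open>The residue of \<open>\<phi>\<^sub>\<alpha>\<close> at its pole \<open>0\<close> is \<open>1\<close>.\<close>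

lemma theta_mult_varphi_tendsto:
  assumes "Im \<tau> > 0" "\<alpha> \<in> {1..3}"
  shows "((\<lambda>z. theta \<tau> (z - p) * varphi \<alpha> \<tau> (z - p)) \<longlongrightarrow> deriv (theta \<tau>) 0) (at p)"
proof -
  let ?w = "half_period \<alpha> \<tau>"
  let ?f = "\<lambda>z. exp (2 * of_real pi * \<i> * (z - p) * deriv (half_period \<alpha>) \<tau>) *
    (theta \<tau> (z - p + ?w) * deriv (theta \<tau>) 0 / theta \<tau> ?w)"
  have "?f holomorphic_on UNIV"
    using theta_half_period_nonzero[OF assms]
    by (intro holomorphic_intros holomorphic_theta_compose[OF assms(1)]) auto
  then have "isCont ?f p"
    using continuous_on_interior[OF holomorphic_on_imp_continuous_on] by force
  then have "(?f \<longlongrightarrow> deriv (theta \<tau>) 0) (at p)"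
    using theta_half_period_nonzero[OF assms] by (simp add: isCont_def)
  moreover have "\<forall>\<^sub>F z in at p. theta \<tau> (z - p) \<noteq> 0"
    using eventually_theta_affine_nonzero[OF assms(1) one_neq_zero, of "- p" p] by simp
  then have "\<forall>\<^sub>F z in at p. ?f z = theta \<tau> (z - p) * varphi \<alpha> \<tau> (z - p)"
    by eventually_elim (simp add: varphi_def kronecker_phi_def)
  ultimately show ?thesis
    by (rule Lim_transform_eventually)
qed

text \<open>The shifted \<open>varphi\<close> is regular at p, since its pole factor theta(z - q) is
  nonzero there, while theta(z - p) tends to 0.\<close>

lemma theta_mult_varphi_tendsto_0:
  assumes "Im \<tau> > 0" "theta \<tau> (p - q) \<noteq> 0"
  shows "((\<lambda>z. theta \<tau> (z - p) * varphi \<alpha> \<tau> (z - q)) \<longlongrightarrow> 0) (at p)"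
proof -
  have cont: "isCont (\<lambda>z. theta \<tau> (z - s + t)) p" for s t
  proof -
    have "(\<lambda>z. theta \<tau> (z - s + t)) holomorphic_on UNIV"
      by (intro holomorphic_intros holomorphic_theta_compose[OF assms(1)])
    then show ?thesis
      using continuous_on_interior[OF holomorphic_on_imp_continuous_on] by force
  qed
  \<comment> \<open>If theta vanishes at the half-period, as it does for \<alpha> = 0, division by
    zero makes \<open>varphi\<close> identically 0.\<close>
  have "isCont (\<lambda>z. theta \<tau> (z - p) * varphi \<alpha> \<tau> (z - q)) p"
  proof (cases "theta \<tau> (half_period \<alpha> \<tau>) = 0")
    case False
    then show ?thesis
      unfolding varphi_def kronecker_phi_def
      using cont[of p 0] cont[of q 0] cont[of q "half_period \<alpha> \<tau>"] assms(2)
      by (intro continuous_intros) simp_all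
  qed (simp add: varphi_def kronecker_phi_def)
  then show ?thesis
    by (simp add: isCont_def theta_0)
qed

text \<open>For these indices the coefficient of \<open>pauli \<alpha>\<close> in the anti-invariant
  part has residue \<open>S b \<alpha>\<close> at the half-period of index b, so its vanishing
  forces this number to be 0.\<close>

lemma invariant_locus_coord_0:
  assumes "Im \<tau> > 0" "S \<in> invariant_locus \<tau>" "\<alpha> \<in> {1..3}" "b \<in> {1..3}" "b \<noteq> \<alpha>"
  shows "S b \<alpha> = 0"
proof -
  let ?p = "half_period b \<tau>"
  let ?c = "\<lambda>a. (1 - varphi_sign \<alpha> a) * S a \<alpha>"
  \<comment> \<open>Twice the coefficient of \<open>pauli \<alpha>\<close>, multiplied by a theta
    factor that cancels the pole at \<open>?p\<close>; the limit there is the residue times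
    theta'(0).\<close>
  let ?g = "\<lambda>z. \<Sum>a=0..3. ?c a * (theta \<tau> (z - ?p) * varphi \<alpha> \<tau> (z - half_period a \<tau>))"
  \<comment> \<open>A cosparse set contains a punctured neighbourhood of every point, so the pole
    itself may be approached.\<close>
  have "\<forall>\<^sub>F z in at ?p. minus_part (lax \<tau> S) z = 0"
    using assms(2) unfolding invariant_locus_def mero_eq_def
    by (auto intro: eventually_cosparse_imp_eventually_at)
  then have ev: "\<forall>\<^sub>F z in at ?p. ?g z = 0"
  proof eventually_elim
    case (elim z)
    have "(lax_coord \<tau> S \<alpha> z + lax_coord \<tau> S \<alpha> (- z)) / 2 = 0"
      using pauli_independent[OF elim[unfolded minus_part_lax] assms(3)] .
    then have "lax_coord \<tau> S \<alpha> z + lax_coord \<tau> S \<alpha> (- z) = 0" by simp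
    also have "lax_coord \<tau> S \<alpha> z + lax_coord \<tau> S \<alpha> (- z) =
        (\<Sum>a=0..3. ?c a * varphi \<alpha> \<tau> (z - half_period a \<tau>))"
      unfolding lax_coord_minus[OF assms(3)] by (simp add: lax_coord_def left_diff_distrib sum_subtractf)
    finally have "theta \<tau> (z - ?p) * (\<Sum>a=0..3. ?c a * varphi \<alpha> \<tau> (z - half_period a \<tau>)) = 0"
      by simp
    then show ?case
      unfolding sum_distrib_left by (simp only: mult_ac)
  qed
  have "(?g \<longlongrightarrow> (\<Sum>a=0..3. ?c a * (if a = b then deriv (theta \<tau>) 0 else 0))) (at ?p)"
  proof (rule tendsto_sum)
    fix a :: nat assume "a \<in> {0..3}"
    \<comment> \<open>The first case carries the pole, the second has coefficient 0 and includes a =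
      0, and the third is regular at \<open>?p\<close>.\<close>
    consider "a = b" | "varphi_sign \<alpha> a = 1" "a \<noteq> b" | "a \<in> {1..3}" "a \<noteq> b"
      using \<open>a \<in> {0..3}\<close> by (cases "a = 0") (auto simp: varphi_sign_def)
    then show "((\<lambda>z. ?c a * (theta \<tau> (z - ?p) * varphi \<alpha> \<tau> (z - half_period a \<tau>)))
        \<longlongrightarrow> ?c a * (if a = b then deriv (theta \<tau>) 0 else 0)) (at ?p)"
    proof cases
      case 1
      then show ?thesis
        using tendsto_mult_left[OF theta_mult_varphi_tendsto[OF assms(1,3), of ?p]] by simp
    next
      case 3
      then show ?thesis
        using tendsto_mult_left[OF theta_mult_varphi_tendsto_0[OF assms(1)
            theta_half_period_diff_nonzero[OF assms(1,4) 3(1)]]] by auto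
    qed simp
  qed
  from tendsto_unique[OF at_neq_bot this tendsto_eventually[OF ev]]
  have "(\<Sum>a=0..3. ?c a * (if a = b then deriv (theta \<tau>) 0 else 0)) = 0" .
  moreover have "(\<Sum>a=0..3. ?c a * (if a = b then deriv (theta \<tau>) 0 else 0)) = ?c b * deriv (theta \<tau>) 0"
    using assms(4) by (subst sum.remove[of _ b]) auto
  ultimately show ?thesis
    using deriv_theta_0_nonzero[OF assms(1)] assms(4,5) by (simp add: varphi_sign_def split: if_splits)
qed

lemma nu_tilde_square_eq_casimir:
  assumes "Im \<tau> > 0" "S \<in> invariant_locus \<tau>" "\<alpha> \<in> {1..3}"
  shows "(nu_tilde S \<alpha>)\<^sup>2 = casimir S \<alpha>"
proof -
  have "casimir S \<alpha> = (S \<alpha> \<alpha>)\<^sup>2 + (\<Sum>\<beta>\<in>{1..3} - {\<alpha>}. (S \<alpha> \<beta>)\<^sup>2)"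
    unfolding casimir_def using assms(3) by (intro sum.remove) auto
  \<comment> \<open>Here \<alpha> labels the point and \<beta> the Pauli matrix, so the roles of the
    two indices in \<open>invariant_locus_coord_0\<close> are exchanged.\<close>
  also have "(\<Sum>\<beta>\<in>{1..3} - {\<alpha>}. (S \<alpha> \<beta>)\<^sup>2) = 0"
    using invariant_locus_coord_0[OF assms(1,2) _ assms(3)] by (intro sum.neutral) auto
  finally show ?thesis
    by (simp add: nu_tilde_def)
qed

text \<open>Being constant up to sign is rendered by two facts: one number \<open>k\<close> per
  Casimir level fixes the value up to sign, and the sign cannot change along a connected
  set.\<close>

theorem proposition5p3:
  fixes \<tau> :: complex and S :: "nat \<Rightarrow> nat \<Rightarrow> complex"
  assumes "Im \<tau> > 0"
  shows "meromorphic_matrix (lax \<tau> S)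
    \<and> plus_part (lax \<tau> S) \<cong>\<^sub>m
        (\<lambda>z. \<Sum>\<alpha>=1..3. (S 0 \<alpha> * varphi \<alpha> \<tau> z
                + nu_tilde S \<alpha> * varphi \<alpha> \<tau> (z - half_period \<alpha> \<tau>)) *\<^sub>m pauli \<alpha>)
    \<and> plus_part (lax \<tau> S) \<cong>\<^sub>m
        (\<lambda>z. \<Sum>\<alpha>=1..3. (S 0 \<alpha> * varphi \<alpha> \<tau> z
                + nu_prime \<tau> S \<alpha> * (1 / varphi \<alpha> \<tau> z)) *\<^sub>m pauli \<alpha>)
    \<and> (S \<in> invariant_locus \<tau> \<longrightarrow> (\<forall>\<alpha>\<in>{1..3}. (nu_tilde S \<alpha>)\<^sup>2 = casimir S \<alpha>))
    \<and> (\<forall>c. \<forall>\<alpha>\<in>{1..3}.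
         (\<exists>k. \<forall>T \<in> invariant_locus \<tau> \<inter> casimir_level c. nu_tilde T \<alpha> = k \<or> nu_tilde T \<alpha> = - k)
       \<and> (\<forall>X \<subseteq> invariant_locus \<tau> \<inter> casimir_level c.
            connected X \<longrightarrow> (\<lambda>T. nu_tilde T \<alpha>) constant_on X))"
proof (intro conjI impI allI ballI)
  show "meromorphic_matrix (lax \<tau> S)"
    by (rule meromorphic_lax[OF assms])
  show "plus_part (lax \<tau> S) \<cong>\<^sub>m
        (\<lambda>z. \<Sum>\<alpha>=1..3. (S 0 \<alpha> * varphi \<alpha> \<tau> z
                + nu_tilde S \<alpha> * varphi \<alpha> \<tau> (z - half_period \<alpha> \<tau>)) *\<^sub>m pauli \<alpha>)"
    unfolding mero_eq_def plus_part_lax by simp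
  have "(\<Sum>\<alpha>=1..3. (S 0 \<alpha> * varphi \<alpha> \<tau> z
      + nu_tilde S \<alpha> * varphi \<alpha> \<tau> (z - half_period \<alpha> \<tau>)) *\<^sub>m pauli \<alpha>) =
    (\<Sum>\<alpha>=1..3. (S 0 \<alpha> * varphi \<alpha> \<tau> z + nu_prime \<tau> S \<alpha> * (1 / varphi \<alpha> \<tau> z)) *\<^sub>m pauli \<alpha>)" for z
    by (intro sum.cong refl) (simp only: varphi_minus_half_period)
  then show "plus_part (lax \<tau> S) \<cong>\<^sub>m
        (\<lambda>z. \<Sum>\<alpha>=1..3. (S 0 \<alpha> * varphi \<alpha> \<tau> z
                + nu_prime \<tau> S \<alpha> * (1 / varphi \<alpha> \<tau> z)) *\<^sub>m pauli \<alpha>)"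
    unfolding mero_eq_def plus_part_lax by simp
  show "(nu_tilde S \<alpha>)\<^sup>2 = casimir S \<alpha>" if "S \<in> invariant_locus \<tau>" "\<alpha> \<in> {1..3}" for \<alpha>
    using nu_tilde_square_eq_casimir[OF assms that] .
  fix c :: "nat \<Rightarrow> complex" and \<alpha> :: nat
  assume \<alpha>: "\<alpha> \<in> {1..3}"
  let ?M = "invariant_locus \<tau> \<inter> casimir_level c"
  have pm: "nu_tilde T \<alpha> = csqrt (c \<alpha>) \<or> nu_tilde T \<alpha> = - csqrt (c \<alpha>)" if "T \<in> ?M" for T
  proof -
    have "(nu_tilde T \<alpha>)\<^sup>2 = (csqrt (c \<alpha>))\<^sup>2"
      using that \<alpha> nu_tilde_square_eq_casimir[OF assms, of T \<alpha>] by (auto simp: casimir_level_def)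
    then show ?thesis unfolding power2_eq_iff .
  qed
  then show "\<exists>k. \<forall>T\<in>?M. nu_tilde T \<alpha> = k \<or> nu_tilde T \<alpha> = - k"
    by blast
  \<comment> \<open>Evaluation at a coordinate is continuous in the product topology, and a
    continuous function with finitely many values is constant on a connected set.\<close>
  show "(\<lambda>T. nu_tilde T \<alpha>) constant_on X" if X: "X \<subseteq> ?M" "connected X" for X
  proof (rule continuous_finite_range_constant[OF X(2)])
    show "continuous_on X (\<lambda>T. nu_tilde T \<alpha>)"
      unfolding nu_tilde_def
      by (rule continuous_on_product_then_coordinatewise[OF continuous_on_product_then_coordinatewise]) (rule continuous_on_id)
    show "finite ((\<lambda>T. nu_tilde T \<alpha>) ` X)"
    proof (rule finite_subset)
      show "(\<lambda>T. nu_tilde T \<alpha>) ` X \<subseteq> {csqrt (c \<alpha>), - csqrt (c \<alpha>)}"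
        using pm X(1) by blast
    qed simp
  qed
qed

end
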